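(* Let $M^{2n+1}$ be a paracontact metric manifold with paracontact metric structure $(\varphi,\xi,\eta,g)$, let $\mathbb D=\ker\eta$ and let $\tau=\mathcal L_\xi g$. Then the tensor field $\nabla_\xi\tau$ satisfies the following properties. (i) $(\nabla_\xi\tau)(X,Y)=(\nabla_\xi\tau)(Y,X)$ for all vector fields $X,Y$. (ii) $(\nabla_\xi\tau)(\xi,\cdot)=0$. (iii) $(\nabla_\xi\tau)(\varphi X,\varphi Y)=(\nabla_\xi\tau)(X,Y)$ for all vector fields $X,Y$. (iv) For $X\in\mathbb D$ with $g(X,X)=\epsilon_X=\pm1$, the sectional curvature $K(\xi,X)$ is given by $$K(\xi,X)=-\tfrac12\epsilon_X(\nabla_\xi\tau)(X,X)-1+\epsilon_X|hX|^2 .$$ (v) $\nabla_\xi\tau=0$ if and only if $K(\xi,X)-K(\xi,Y)=\epsilon_X|hX|^2-\epsilon_Y|hY|^2$ for every $X,Y\in\mathbb D$ (tangent at the same point) with $g(X,X)=\epsilon_X=\pm1$ and $g(Y,Y)=\epsilon_Y=\pm1$. (vi) If $n=1$, then for all $X,Y$ $$-(\nabla_\xi\tau)(X,Y)=\mathrm{Ric}(X,Y)+\mathrm{Ric}(\varphi X,\varphi Y)-\eta(X)\mathrm{Ric}(\xi,Y)-\eta(Y)\mathrm{Ric}(\xi,X)+\eta(X)\eta(Y)\mathrm{Ric}(\xi,\xi).$$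
   Context: An almost paracontact structure on a smooth $(2n+1)$-manifold $M$ is a triple $(\varphi,\xi,\eta)$ of a $(1,1)$-tensor field, a vector field and a 1-form with $\varphi\xi=0$, $\eta\circ\varphi=0$, $\eta(\xi)=1$, $\varphi^2=\mathrm{id}-\eta\otimes\xi$, and such that $\varphi$ induces an almost paracomplex structure on the distribution $\mathbb D=\ker\eta$ (its $\pm1$-eigendistributions in $\mathbb D$ have equal rank $n$). A compatible metric is a pseudo-Riemannian metric $g$ with $g(\varphi X,\varphi Y)=-g(X,Y)+\eta(X)\eta(Y)$; it has signature $(n+1,n)$ and $\eta(X)=g(X,\xi)$. The structure $(\varphi,\xi,\eta,g)$ is a paracontact metric structure, and $M$ a paracontact metric manifold, if in addition $g(X,\varphi Y)=d\eta(X,Y)$, where $d\eta(X,Y)=\frac12\big(X\eta(Y)-Y\eta(X)-\eta([X,Y])\big)$. Notation: $\nabla$ is the Levi-Civita connection of $g$; $R(X,Y)Z=\nabla_X\nabla_YZ-\nabla_Y\nabla_XZ-\nabla_{[X,Y]}Z$ and $R(X,Y,Z,W)=g(R(X,Y)Z,W)$; $\mathrm{Ric}(Y,Z)$ is the trace of $X\mapsto R(X,Y)Z$; $\mathcal L$ is the Lie derivative; $\tau=\mathcal L_\xi g$; $h=\frac12\mathcal L_\xi\varphi$. For $X\in\mathbb D$ with $g(X,X)=\epsilon_X=\pm1$, $K(\xi,X)=\epsilon_X R(X,\xi,\xi,X)$; and $|hX|^2=g(hX,hX)$ (possibly negative). *)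

theory Defs
  imports "HOL-Analysis.Analysis" "HOL-Library.Function_Algebras"
begin

text \<open>
  Real functions on a manifold, tangent vectors and vector fields are all functions, so they are
  added and scaled pointwise; with this instance the library's \<open>span\<close>, \<open>dim\<close>, \<open>independent\<close> and
  \<open>representation\<close> apply to tangent spaces.
\<close>

instantiation "fun" :: (type, real_vector) real_vector
begin

definition scaleR_fun :: "real \<Rightarrow> ('a \<Rightarrow> 'b) \<Rightarrow> 'a \<Rightarrow> 'b"
  where "scaleR_fun r f = (\<lambda>x. r *\<^sub>R f x)"

instance
  by standard (simp_all add: scaleR_fun_def fun_eq_iff scaleR_add_right scaleR_add_left)

end


section \<open>Smooth manifolds\<close>

text \<open>Intended for open \<open>S\<close> in a finite-dimensional space.\<close>

primrec Ck_on :: "nat \<Rightarrow> 'a::real_normed_vector set \<Rightarrow> ('a \<Rightarrow> 'b::real_normed_vector) \<Rightarrow> bool"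
  where
    "Ck_on 0 S f \<longleftrightarrow> continuous_on S f"
  | "Ck_on (Suc k) S f \<longleftrightarrow>
       (\<forall>x\<in>S. f differentiable (at x)) \<and> (\<forall>v. Ck_on k S (\<lambda>x. frechet_derivative f (at x) v))"

definition smooth_on :: "'a::real_normed_vector set \<Rightarrow> ('a \<Rightarrow> 'b::real_normed_vector) \<Rightarrow> bool"
  where "smooth_on S f \<longleftrightarrow> (\<forall>k. Ck_on k S f)"

text \<open>
  A chart is a pair \<open>(U, c)\<close> of an open set and a coordinate map, whose values outside \<open>U\<close> are
  irrelevant. The manifold is the whole type \<open>'a\<close>; the sort constraints of the main theorem make it
  Hausdorff and second countable.
\<close>

type_synonym ('a, 'e) atlas = "('a set \<times> ('a \<Rightarrow> 'e)) set"

definition chart :: "'a::topological_space set \<Rightarrow> ('a \<Rightarrow> 'e::euclidean_space) \<Rightarrow> bool"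
  where "chart U c \<longleftrightarrow> open U \<and> open (c ` U) \<and> homeomorphism U (c ` U) c (inv_into U c)"

definition smooth_atlas :: "('a::topological_space, 'e::euclidean_space) atlas \<Rightarrow> bool"
  where "smooth_atlas A \<longleftrightarrow>
    (\<forall>(U, c)\<in>A. chart U c) \<and> (\<Union>(U, c)\<in>A. U) = UNIV \<and>
    (\<forall>(U, c)\<in>A. \<forall>(V, d)\<in>A. smooth_on (c ` (U \<inter> V)) (d \<circ> inv_into U c))"

definition smooth_functions :: "('a::topological_space, 'e::euclidean_space) atlas \<Rightarrow> ('a \<Rightarrow> real) set"
  where "smooth_functions A = {f. \<forall>(U, c)\<in>A. smooth_on (c ` U) (f \<circ> inv_into U c)}"


section \<open>Tangent vectors, vector fields and tensor fields\<close>

type_synonym 'a tangent_vector = "('a \<Rightarrow> real) \<Rightarrow> real"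
type_synonym 'a vector_field = "'a \<Rightarrow> 'a tangent_vector"

text \<open>
  Tangent vectors at \<open>p\<close> are the derivations at \<open>p\<close> of the algebra of smooth functions. They are
  made zero on non-smooth functions, so that equal derivations are equal as functions.
\<close>

definition tangent_space ::
  "('a::topological_space, 'e::euclidean_space) atlas \<Rightarrow> 'a \<Rightarrow> 'a tangent_vector set"
  where "tangent_space A p = {v.
    (\<forall>f. f \<notin> smooth_functions A \<longrightarrow> v f = 0) \<and>
    (\<forall>f\<in>smooth_functions A. \<forall>g\<in>smooth_functions A. v (\<lambda>q. f q + g q) = v f + v g) \<and>
    (\<forall>r. \<forall>f\<in>smooth_functions A. v (\<lambda>q. r * f q) = r * v f) \<and>
    (\<forall>f\<in>smooth_functions A. \<forall>g\<in>smooth_functions A.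
       v (\<lambda>q. f q * g q) = v f * g p + f p * v g)}"

definition lie_action :: "'a vector_field \<Rightarrow> ('a \<Rightarrow> real) \<Rightarrow> 'a \<Rightarrow> real"
  where "lie_action X f = (\<lambda>p. X p f)"

definition vector_fields ::
  "('a::topological_space, 'e::euclidean_space) atlas \<Rightarrow> 'a vector_field set"
  where "vector_fields A = {X. (\<forall>p. X p \<in> tangent_space A p) \<and>
    (\<forall>f\<in>smooth_functions A. lie_action X f \<in> smooth_functions A)}"

definition fmult :: "('a \<Rightarrow> real) \<Rightarrow> 'a vector_field \<Rightarrow> 'a vector_field"
  where "fmult f X = (\<lambda>p. f p *\<^sub>R X p)"

definition bracket :: "'a vector_field \<Rightarrow> 'a vector_field \<Rightarrow> 'a vector_field"
  where "bracket X Y = (\<lambda>p f. X p (lie_action Y f) - Y p (lie_action X f))"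

text \<open>
  Tensor fields are families of multilinear maps on the tangent spaces, with smoothness tested on
  smooth vector fields.
\<close>

definition linear_from :: "'v::real_vector set \<Rightarrow> ('v \<Rightarrow> 'w::real_vector) \<Rightarrow> bool"
  where "linear_from V f \<longleftrightarrow>
    (\<forall>u\<in>V. \<forall>v\<in>V. f (u + v) = f u + f v) \<and> (\<forall>r. \<forall>u\<in>V. f (r *\<^sub>R u) = r *\<^sub>R f u)"

definition app :: "('a \<Rightarrow> 'a tangent_vector \<Rightarrow> 'b) \<Rightarrow> 'a vector_field \<Rightarrow> 'a \<Rightarrow> 'b"
  where "app T X = (\<lambda>p. T p (X p))"

definition app2 ::
  "('a \<Rightarrow> 'a tangent_vector \<Rightarrow> 'a tangent_vector \<Rightarrow> 'b) \<Rightarrow> 'a vector_field \<Rightarrow> 'a vector_field \<Rightarrow> 'a \<Rightarrow> 'b"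
  where "app2 T X Y = (\<lambda>p. T p (X p) (Y p))"

definition one_form ::
  "('a::topological_space, 'e::euclidean_space) atlas \<Rightarrow> ('a \<Rightarrow> 'a tangent_vector \<Rightarrow> real) \<Rightarrow> bool"
  where "one_form A \<omega> \<longleftrightarrow>
    (\<forall>p. linear_from (tangent_space A p) (\<omega> p)) \<and>
    (\<forall>X\<in>vector_fields A. app \<omega> X \<in> smooth_functions A)"

definition endomorphism_field ::
  "('a::topological_space, 'e::euclidean_space) atlas
     \<Rightarrow> ('a \<Rightarrow> 'a tangent_vector \<Rightarrow> 'a tangent_vector) \<Rightarrow> bool"
  where "endomorphism_field A F \<longleftrightarrow>
    (\<forall>p. linear_from (tangent_space A p) (F p) \<and> F p ` tangent_space A p \<subseteq> tangent_space A p) \<and>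
    (\<forall>X\<in>vector_fields A. app F X \<in> vector_fields A)"

definition pseudo_riemannian_metric ::
  "('a::topological_space, 'e::euclidean_space) atlas
     \<Rightarrow> ('a \<Rightarrow> 'a tangent_vector \<Rightarrow> 'a tangent_vector \<Rightarrow> real) \<Rightarrow> bool"
  where "pseudo_riemannian_metric A g \<longleftrightarrow>
    (\<forall>p. \<forall>u\<in>tangent_space A p. linear_from (tangent_space A p) (g p u)) \<and>
    (\<forall>p. \<forall>u\<in>tangent_space A p. \<forall>v\<in>tangent_space A p. g p u v = g p v u) \<and>
    (\<forall>p. \<forall>u\<in>tangent_space A p. (\<forall>v\<in>tangent_space A p. g p u v = 0) \<longrightarrow> u = 0) \<and>
    (\<forall>X\<in>vector_fields A. \<forall>Y\<in>vector_fields A. app2 g X Y \<in> smooth_functions A)"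


section \<open>Paracontact metric manifolds\<close>

definition exterior_derivative ::
  "('a \<Rightarrow> 'a tangent_vector \<Rightarrow> real) \<Rightarrow> 'a vector_field \<Rightarrow> 'a vector_field \<Rightarrow> 'a \<Rightarrow> real"
  where "exterior_derivative \<omega> X Y = (\<lambda>p.
    (lie_action X (app \<omega> Y) p - lie_action Y (app \<omega> X) p - app \<omega> (bracket X Y) p) / 2)"

text \<open>
  On the contact distribution \<open>\<phi>\<close> squares to the identity, so that the two eigenspaces below span it
  and the rank condition is all that remains of ``almost paracomplex''.
\<close>

definition almost_paracontact ::
  "('a::topological_space, 'e::euclidean_space) atlas \<Rightarrow> nat
     \<Rightarrow> ('a \<Rightarrow> 'a tangent_vector \<Rightarrow> 'a tangent_vector) \<Rightarrow> 'a vector_field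
     \<Rightarrow> ('a \<Rightarrow> 'a tangent_vector \<Rightarrow> real) \<Rightarrow> bool"
  where "almost_paracontact A n \<phi> \<xi> \<eta> \<longleftrightarrow>
    endomorphism_field A \<phi> \<and> \<xi> \<in> vector_fields A \<and> one_form A \<eta> \<and>
    (\<forall>p. \<phi> p (\<xi> p) = 0 \<and> \<eta> p (\<xi> p) = 1 \<and>
       (\<forall>u\<in>tangent_space A p. \<eta> p (\<phi> p u) = 0 \<and> \<phi> p (\<phi> p u) = u - \<eta> p u *\<^sub>R \<xi> p) \<and>
       dim {u \<in> tangent_space A p. \<eta> p u = 0 \<and> \<phi> p u = u} = n \<and>
       dim {u \<in> tangent_space A p. \<eta> p u = 0 \<and> \<phi> p u = - u} = n)"

text \<open>
  The signature \<open>(n + 1, n)\<close> and \<open>\<eta> = g(\<cdot>, \<xi>)\<close> are consequences of compatibility.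
\<close>

definition compatible_metric ::
  "('a::topological_space, 'e::euclidean_space) atlas
     \<Rightarrow> ('a \<Rightarrow> 'a tangent_vector \<Rightarrow> 'a tangent_vector)
     \<Rightarrow> ('a \<Rightarrow> 'a tangent_vector \<Rightarrow> real)
     \<Rightarrow> ('a \<Rightarrow> 'a tangent_vector \<Rightarrow> 'a tangent_vector \<Rightarrow> real) \<Rightarrow> bool"
  where "compatible_metric A \<phi> \<eta> g \<longleftrightarrow>
    pseudo_riemannian_metric A g \<and>
    (\<forall>p. \<forall>u\<in>tangent_space A p. \<forall>v\<in>tangent_space A p.
       g p (\<phi> p u) (\<phi> p v) = - g p u v + \<eta> p u * \<eta> p v)"

definition paracontact_metric_manifold ::
  "('a::topological_space, 'e::euclidean_space) atlas \<Rightarrow> nat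
     \<Rightarrow> ('a \<Rightarrow> 'a tangent_vector \<Rightarrow> 'a tangent_vector) \<Rightarrow> 'a vector_field
     \<Rightarrow> ('a \<Rightarrow> 'a tangent_vector \<Rightarrow> real)
     \<Rightarrow> ('a \<Rightarrow> 'a tangent_vector \<Rightarrow> 'a tangent_vector \<Rightarrow> real) \<Rightarrow> bool"
  where "paracontact_metric_manifold A n \<phi> \<xi> \<eta> g \<longleftrightarrow>
    smooth_atlas A \<and> DIM('e) = 2 * n + 1 \<and>
    almost_paracontact A n \<phi> \<xi> \<eta> \<and> compatible_metric A \<phi> \<eta> g \<and>
    (\<forall>X\<in>vector_fields A. \<forall>Y\<in>vector_fields A.
       app2 g X (app \<phi> Y) = exterior_derivative \<eta> X Y)"


section \<open>Levi-Civita connection, curvature, Lie derivatives\<close>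

text \<open>
  From here on tensor fields such as \<open>\<L>\<^sub>\<xi>g\<close>, \<open>\<nabla>\<^sub>\<xi>\<tau>\<close> or \<open>R\<close> are operators on vector fields that are
  linear over the smooth functions; only their values on \<^term>\<open>vector_fields A\<close> are meaningful.
  A statement about tangent vectors at \<open>p\<close> is phrased for \<open>X p\<close> with a vector field \<open>X\<close>: every
  tangent vector extends to a global smooth field, and the tensors at \<open>p\<close> see only \<open>X p\<close>.
\<close>

definition affine_connection ::
  "('a::topological_space, 'e::euclidean_space) atlas
     \<Rightarrow> ('a vector_field \<Rightarrow> 'a vector_field \<Rightarrow> 'a vector_field) \<Rightarrow> bool"
  where "affine_connection A nabla \<longleftrightarrow>
    (\<forall>X\<in>vector_fields A. \<forall>Y\<in>vector_fields A. nabla X Y \<in> vector_fields A) \<and>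
    (\<forall>X\<in>vector_fields A. \<forall>Y\<in>vector_fields A. \<forall>Z\<in>vector_fields A.
       nabla (X + Y) Z = nabla X Z + nabla Y Z \<and> nabla X (Y + Z) = nabla X Y + nabla X Z) \<and>
    (\<forall>f\<in>smooth_functions A. \<forall>X\<in>vector_fields A. \<forall>Y\<in>vector_fields A.
       nabla (fmult f X) Y = fmult f (nabla X Y) \<and>
       nabla X (fmult f Y) = fmult (lie_action X f) Y + fmult f (nabla X Y))"

definition levi_civita_connection ::
  "('a::topological_space, 'e::euclidean_space) atlas
     \<Rightarrow> ('a \<Rightarrow> 'a tangent_vector \<Rightarrow> 'a tangent_vector \<Rightarrow> real)
     \<Rightarrow> ('a vector_field \<Rightarrow> 'a vector_field \<Rightarrow> 'a vector_field) \<Rightarrow> bool"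
  where "levi_civita_connection A g nabla \<longleftrightarrow>
    affine_connection A nabla \<and>
    (\<forall>X\<in>vector_fields A. \<forall>Y\<in>vector_fields A. nabla X Y - nabla Y X = bracket X Y) \<and>
    (\<forall>X\<in>vector_fields A. \<forall>Y\<in>vector_fields A. \<forall>Z\<in>vector_fields A.
       lie_action X (app2 g Y Z) = app2 g (nabla X Y) Z + app2 g Y (nabla X Z))"

definition curvature ::
  "('a vector_field \<Rightarrow> 'a vector_field \<Rightarrow> 'a vector_field)
     \<Rightarrow> 'a vector_field \<Rightarrow> 'a vector_field \<Rightarrow> 'a vector_field \<Rightarrow> 'a vector_field"
  where "curvature nabla X Y Z = nabla X (nabla Y Z) - nabla Y (nabla X Z) - nabla (bracket X Y) Z"

definition curvature4 ::
  "('a \<Rightarrow> 'a tangent_vector \<Rightarrow> 'a tangent_vector \<Rightarrow> real)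
     \<Rightarrow> ('a vector_field \<Rightarrow> 'a vector_field \<Rightarrow> 'a vector_field)
     \<Rightarrow> 'a vector_field \<Rightarrow> 'a vector_field \<Rightarrow> 'a vector_field \<Rightarrow> 'a vector_field \<Rightarrow> 'a \<Rightarrow> real"
  where "curvature4 g nabla X Y Z W = app2 g (curvature nabla X Y Z) W"

text \<open>\<open>\<epsilon>\<^sub>X R(X, \<xi>, \<xi>, X)\<close> with \<open>\<epsilon>\<^sub>X = g(X, X)\<close>, for \<open>X\<close> orthogonal to \<open>\<xi>\<close> and \<open>g(X, X) = \<plusminus>1\<close> at \<open>p\<close>.\<close>

definition xi_sectional_curvature ::
  "('a \<Rightarrow> 'a tangent_vector \<Rightarrow> 'a tangent_vector \<Rightarrow> real)
     \<Rightarrow> ('a vector_field \<Rightarrow> 'a vector_field \<Rightarrow> 'a vector_field)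
     \<Rightarrow> 'a vector_field \<Rightarrow> 'a vector_field \<Rightarrow> 'a \<Rightarrow> real"
  where "xi_sectional_curvature g nabla \<xi> X p = app2 g X X p * curvature4 g nabla X \<xi> \<xi> X p"

text \<open>The value does not depend on the chosen basis of the finite-dimensional subspace \<open>V\<close>.\<close>

definition trace_on :: "'v::real_vector set \<Rightarrow> ('v \<Rightarrow> 'v) \<Rightarrow> real"
  where "trace_on V F =
    (let B = (SOME B. independent B \<and> span B = V) in \<Sum>b\<in>B. representation B (F b) b)"

text \<open>
  The endomorphism of the tangent space at \<open>p\<close> induced by a tensorial operator \<open>F\<close> on vector fields:
  \<open>u\<close> goes to the value at \<open>p\<close> of \<open>F X\<close>, for any vector field \<open>X\<close> that extends \<open>u\<close>.
\<close>

definition at_point ::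
  "('a::topological_space, 'e::euclidean_space) atlas \<Rightarrow> 'a
     \<Rightarrow> ('a vector_field \<Rightarrow> 'a vector_field) \<Rightarrow> 'a tangent_vector \<Rightarrow> 'a tangent_vector"
  where "at_point A p F u = (THE w. \<exists>X\<in>vector_fields A. X p = u \<and> F X p = w)"

definition ricci ::
  "('a::topological_space, 'e::euclidean_space) atlas
     \<Rightarrow> ('a vector_field \<Rightarrow> 'a vector_field \<Rightarrow> 'a vector_field)
     \<Rightarrow> 'a vector_field \<Rightarrow> 'a vector_field \<Rightarrow> 'a \<Rightarrow> real"
  where "ricci A nabla Y Z p =
    trace_on (tangent_space A p) (at_point A p (\<lambda>X. curvature nabla X Y Z))"

definition lie_derivative_metric ::
  "'a vector_field \<Rightarrow> ('a \<Rightarrow> 'a tangent_vector \<Rightarrow> 'a tangent_vector \<Rightarrow> real)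
     \<Rightarrow> 'a vector_field \<Rightarrow> 'a vector_field \<Rightarrow> 'a \<Rightarrow> real"
  where "lie_derivative_metric \<xi> g X Y =
    lie_action \<xi> (app2 g X Y) - app2 g (bracket \<xi> X) Y - app2 g X (bracket \<xi> Y)"

definition lie_derivative_endomorphism ::
  "'a vector_field \<Rightarrow> ('a \<Rightarrow> 'a tangent_vector \<Rightarrow> 'a tangent_vector)
     \<Rightarrow> 'a vector_field \<Rightarrow> 'a vector_field"
  where "lie_derivative_endomorphism \<xi> \<phi> X = bracket \<xi> (app \<phi> X) - app \<phi> (bracket \<xi> X)"

definition h_tensor ::
  "'a vector_field \<Rightarrow> ('a \<Rightarrow> 'a tangent_vector \<Rightarrow> 'a tangent_vector)
     \<Rightarrow> 'a vector_field \<Rightarrow> 'a vector_field"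
  where "h_tensor \<xi> \<phi> X = (1/2) *\<^sub>R lie_derivative_endomorphism \<xi> \<phi> X"

definition covariant_derivative ::
  "('a vector_field \<Rightarrow> 'a vector_field \<Rightarrow> 'a vector_field) \<Rightarrow> 'a vector_field
     \<Rightarrow> ('a vector_field \<Rightarrow> 'a vector_field \<Rightarrow> 'a \<Rightarrow> real)
     \<Rightarrow> 'a vector_field \<Rightarrow> 'a vector_field \<Rightarrow> 'a \<Rightarrow> real"
  where "covariant_derivative nabla Z T X Y =
    lie_action Z (T X Y) - T (nabla Z X) Y - T X (nabla Z Y)"

end

theory Submission
  imports Defs "HOL-Computational_Algebra.Polynomial"
begin

text \<open>
  Write \<open>S = \<nabla>\<xi>\<close>. Since \<open>d\<eta>\<close> is closed and \<open>d\<eta>(\<xi>, \<cdot>) = 0\<close>, it is invariant under \<open>\<L>\<^sub>\<xi>\<close>; differentiating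
  \<open>\<phi>\<^sup>2 = id - \<eta> \<otimes> \<xi>\<close> along \<open>\<xi>\<close> as well gives \<open>\<tau>(\<phi>X, \<phi>Y) = \<tau>(X, Y)\<close>, hence \<open>\<nabla>\<^sub>\<xi>\<phi> = 0\<close> and
  \<open>S = -\<phi> + \<phi>h\<close>. So \<open>\<nabla>\<^sub>\<xi>\<tau>\<close> is twice \<open>g((\<nabla>\<^sub>\<xi>S)X, Y)\<close>, and \<open>R(X, \<xi>)\<xi> = -(\<nabla>\<^sub>\<xi>S)X - S\<^sup>2X\<close> becomes
  \<open>R(X, \<xi>, \<xi>, Y) = -(\<nabla>\<^sub>\<xi>\<tau>)(X, Y)/2 - g(X, Y) + \<eta>(X)\<eta>(Y) + g(hX, hY)\<close>, from which (iv), (v) and,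
  after adding the same identity for \<open>\<phi>X, \<phi>Y\<close>, the \<open>\<xi>\<close>-part of the trace in (vi) can be read off.
  The rest of that trace runs over a null frame of \<open>\<phi>\<close>-eigenvectors of the contact plane, where the
  contributions of \<open>(X, Y)\<close> and \<open>(\<phi>X, \<phi>Y)\<close> cancel. The Ricci tensor is a trace over the tangent
  space, so this last step also needs that tangent vectors extend to global vector fields.
\<close>

section \<open>Calculus of smooth functions\<close>

text \<open>The obstacle is that tangent vectors are derivations of the algebra of global smooth
  functions, so the dimension of a tangent space cannot be read off. Up to (v) every claim concerns
  fields and can be argued by pairing with arbitrary fields. For (vi) the structure itself supplies
  the upper bound: when \<open>n = 1\<close>, the rank condition makes \<open>\<xi>\<close> and two
  eigenvectors of \<open>\<phi>\<close> span, while bump functions turn the coordinate fields into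
  global fields with three independent values. Counting then shows that every tangent vector is the
  value of a field. The sign of |hX|^2 in (iv) comes from \<open>\<phi>\<close> being an
  anti-isometry of the contact distribution: g(\<phi>hX, \<phi>hX) = -g(hX, hX). The same property
  makes its eigenvectors E, F null. The cancellation in (vi) rests on R(E, Y, Z, F) vanishing for Y
  = E and for Z = F: on the contact plane a single coefficient remains, belonging to Y = F and Z =
  E, and \<open>\<phi>\<close> has opposite eigenvalues there.\<close>

lemma Ck_on_cong:
  assumes "open S" and "\<And>x. x \<in> S \<Longrightarrow> f x = g x"
  shows "Ck_on k S f \<longleftrightarrow> Ck_on k S g"
  using assms(2)
proof (induction k arbitrary: f g)
  case 0
  then show ?case by (simp cong: continuous_on_cong)
next
  case (Suc k)
  have hd: "(f has_derivative D) (at x) \<longleftrightarrow> (g has_derivative D) (at x)" if "x \<in> S" for x D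
    using has_derivative_transform_within_open[OF _ \<open>open S\<close> that, of f D UNIV g]
      has_derivative_transform_within_open[OF _ \<open>open S\<close> that, of g D UNIV f] Suc.prems
    by auto
  have "f differentiable (at x) \<longleftrightarrow> g differentiable (at x)" if "x \<in> S" for x
    using hd[OF that] by (simp add: differentiable_def)
  moreover have "frechet_derivative f (at x) = frechet_derivative g (at x)" if "x \<in> S" for x
    using hd[OF that] by (simp add: frechet_derivative_def)
  ultimately show ?case
    using Suc.IH[of "\<lambda>x. frechet_derivative f (at x) v" "\<lambda>x. frechet_derivative g (at x) v" for v]
    by simp
qed

lemma Ck_on_SucD: "Ck_on (Suc k) S f \<Longrightarrow> Ck_on k S f"
proof (induction k arbitrary: f)
  case 0
  then show ?case
    by (auto intro!: continuous_at_imp_continuous_on differentiable_imp_continuous_within)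
next
  case (Suc k)
  then show ?case by (metis Ck_on.simps(2))
qed

lemma Ck_on_subset: "Ck_on k S f \<Longrightarrow> T \<subseteq> S \<Longrightarrow> Ck_on k T f"
proof (induction k arbitrary: f)
  case 0
  then show ?case using continuous_on_subset by auto
qed auto

lemma Ck_on_local:
  assumes "\<And>x. x \<in> S \<Longrightarrow> \<exists>T. open T \<and> x \<in> T \<and> Ck_on k T f"
  shows "Ck_on k S f"
  using assms
proof (induction k arbitrary: f)
  case 0
  then show ?case
    by (metis Ck_on.simps(1) continuous_at_imp_continuous_on continuous_on_eq_continuous_at)
next
  case (Suc k)
  show ?case
    unfolding Ck_on.simps
  proof (intro conjI ballI allI)
    fix x assume "x \<in> S"
    then show "f differentiable at x" using Suc.prems by fastforce
  next
    fix v
    show "Ck_on k S (\<lambda>x. frechet_derivative f (at x) v)"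
      by (rule Suc.IH) (use Suc.prems in fastforce)
  qed
qed

text \<open>\<open>frechet_derivative\<close> is given by choice; on an open set any explicit
  derivative may replace it, which lets the closure properties go by induction on
  \<open>k\<close>.\<close>

lemma Ck_on_SucI:
  assumes "open S" and "\<And>x. x \<in> S \<Longrightarrow> (f has_derivative f' x) (at x)"
    and "\<And>v. Ck_on k S (\<lambda>x. f' x v)"
  shows "Ck_on (Suc k) S f"
proof -
  have "frechet_derivative f (at x) = f' x" if "x \<in> S" for x
    using assms(2)[OF that] frechet_derivative_at by metis
  then have "Ck_on k S (\<lambda>x. frechet_derivative f (at x) v)" for v
    using assms(3)[of v] by (subst Ck_on_cong[OF assms(1), where g = "\<lambda>x. f' x v"]) auto
  then show ?thesis using assms(2) by (auto simp: differentiable_def)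
qed

lemma Ck_on_Suc_has_derivative:
  "Ck_on (Suc k) S f \<Longrightarrow> x \<in> S \<Longrightarrow> (f has_derivative frechet_derivative f (at x)) (at x)"
  by (simp add: frechet_derivative_works)

lemma Ck_on_const: "Ck_on k S (\<lambda>_. c)"
  by (induction k arbitrary: c) simp_all

lemma Ck_on_add:
  assumes "open S" "Ck_on k S f" "Ck_on k S g"
  shows "Ck_on k S (\<lambda>x. f x + g x)"
  using assms(2,3)
proof (induction k arbitrary: f g)
  case 0
  then show ?case by (simp add: continuous_on_add)
next
  case (Suc k)
  show ?case
    by (rule Ck_on_SucI[OF \<open>open S\<close> has_derivative_add[OF Ck_on_Suc_has_derivative
        Ck_on_Suc_has_derivative, OF Suc.prems(1) _ Suc.prems(2)]])
      (use Suc in auto)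
qed

lemma Ck_on_sum:
  assumes "open S" and "\<And>i. i \<in> I \<Longrightarrow> Ck_on k S (f i)"
  shows "Ck_on k S (\<lambda>x. \<Sum>i\<in>I. f i x)"
  using assms(2)
  by (induction I rule: infinite_finite_induct) (auto simp: Ck_on_const intro!: Ck_on_add assms(1))

lemma Ck_on_bounded_linear:
  assumes "open S" "bounded_linear L" "Ck_on k S f"
  shows "Ck_on k S (\<lambda>x. L (f x))"
  using assms(3)
proof (induction k arbitrary: f)
  case 0
  then show ?case using bounded_linear.continuous_on[OF assms(2)] by auto
next
  case (Suc k)
  show ?case
    by (rule Ck_on_SucI[OF \<open>open S\<close> bounded_linear.has_derivative[OF assms(2)
        Ck_on_Suc_has_derivative, OF Suc.prems]])
      (use Suc in auto)
qed

lemma Ck_on_scaleR: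
  assumes "open S" "Ck_on k S f" "Ck_on k S g"
  shows "Ck_on k S (\<lambda>x. f x *\<^sub>R g x)"
  using assms(2,3)
proof (induction k arbitrary: f g)
  case 0
  then show ?case by (simp add: continuous_on_scaleR)
next
  case (Suc k)
  show ?case
    by (rule Ck_on_SucI[OF \<open>open S\<close> has_derivative_scaleR[OF Ck_on_Suc_has_derivative
        Ck_on_Suc_has_derivative, OF Suc.prems(1) _ Suc.prems(2)]])
      (use Suc.prems Ck_on_SucD[OF Suc.prems(1)] Ck_on_SucD[OF Suc.prems(2)]
        in \<open>auto intro!: Ck_on_add assms(1) Suc.IH\<close>)
qed

text \<open>By the chain rule the derivative of the composite in direction \<open>v\<close> is
  \<open>?f' (g x)\<close> applied to \<open>?g' x v\<close>, a direction that moves with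
  \<open>x\<close>, whereas \<open>Ck_on\<close> controls fixed directions only. Expanding the
  moving direction in the standard basis leaves sums of products of scalar functions with composites
  to which the induction hypothesis applies.\<close>

lemma Ck_on_compose:
  fixes g :: "'c::real_normed_vector \<Rightarrow> 'd::euclidean_space"
  assumes "open S" "open T" "g ` S \<subseteq> T" "Ck_on k T f" "Ck_on k S g"
  shows "Ck_on k S (\<lambda>x. f (g x))"
  using assms(4,5)
proof (induction k arbitrary: f)
  case 0
  then show ?case using assms(3) by (auto intro: continuous_on_compose2)
next
  case (Suc k)
  let ?f' = "\<lambda>y. frechet_derivative f (at y)" and ?g' = "\<lambda>x. frechet_derivative g (at x)"
  have f': "(f has_derivative ?f' (g x)) (at (g x))" if "x \<in> S" for x
    using Ck_on_Suc_has_derivative[OF Suc.prems(1)] assms(3) that by auto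
  have g': "(g has_derivative ?g' x) (at x)" if "x \<in> S" for x
    using Ck_on_Suc_has_derivative[OF Suc.prems(2)] that by auto
  have lin: "?f' (g x) w = (\<Sum>b\<in>Basis. (w \<bullet> b) *\<^sub>R ?f' (g x) b)" if "x \<in> S" for x w
  proof -
    have "linear (?f' (g x))" using f'[OF that] by (rule has_derivative_linear)
    then have "(\<Sum>b\<in>Basis. (w \<bullet> b) *\<^sub>R ?f' (g x) b) = ?f' (g x) (\<Sum>b\<in>Basis. (w \<bullet> b) *\<^sub>R b)"
      by (simp add: linear_sum linear_scale)
    then show ?thesis by (simp add: euclidean_representation)
  qed
  show ?case
  proof (rule Ck_on_SucI[OF \<open>open S\<close> has_derivative_compose[OF g' f']])
    fix v
    have "Ck_on k S (\<lambda>x. ?f' (g x) b)" for b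
      using Suc.IH[of "\<lambda>y. ?f' y b"] Suc.prems(1) Ck_on_SucD[OF Suc.prems(2)] by simp
    moreover have "Ck_on k S (\<lambda>x. ?g' x v \<bullet> b)" for b
      by (rule Ck_on_bounded_linear[OF \<open>open S\<close> bounded_linear_inner_left])
        (use Suc.prems(2) in simp)
    ultimately have "Ck_on k S (\<lambda>x. \<Sum>b\<in>Basis. (?g' x v \<bullet> b) *\<^sub>R ?f' (g x) b)"
      by (intro Ck_on_sum Ck_on_scaleR \<open>open S\<close>)
    moreover have "Ck_on k S (\<lambda>x. ?f' (g x) (?g' x v))
        \<longleftrightarrow> Ck_on k S (\<lambda>x. \<Sum>b\<in>Basis. (?g' x v \<bullet> b) *\<^sub>R ?f' (g x) b)"
      by (rule Ck_on_cong[OF \<open>open S\<close> lin])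
    ultimately show "Ck_on k S (\<lambda>x. ?f' (g x) (?g' x v))" by blast
  qed
qed

lemma smooth_on_cong:
  "open S \<Longrightarrow> (\<And>x. x \<in> S \<Longrightarrow> f x = g x) \<Longrightarrow> smooth_on S f \<longleftrightarrow> smooth_on S g"
  unfolding smooth_on_def using Ck_on_cong[of S f g] by auto

lemma smooth_on_subset: "smooth_on S f \<Longrightarrow> T \<subseteq> S \<Longrightarrow> smooth_on T f"
  unfolding smooth_on_def using Ck_on_subset by blast

lemma smooth_on_Un:
  assumes "open S" "open T" "smooth_on S f" "smooth_on T f"
  shows "smooth_on (S \<union> T) f"
  unfolding smooth_on_def
proof (intro allI Ck_on_local)
  fix k x assume "x \<in> S \<union> T"
  moreover have "Ck_on k S f" "Ck_on k T f" using assms(3,4) by (simp_all add: smooth_on_def)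
  ultimately show "\<exists>U. open U \<and> x \<in> U \<and> Ck_on k U f" using assms(1,2) by auto
qed

lemma smooth_on_const: "smooth_on S (\<lambda>_. c)"
  by (simp add: smooth_on_def Ck_on_const)

lemma smooth_on_add:
  "open S \<Longrightarrow> smooth_on S f \<Longrightarrow> smooth_on S g \<Longrightarrow> smooth_on S (\<lambda>x. f x + g x)"
  by (simp add: smooth_on_def Ck_on_add)

lemma smooth_on_mult:
  fixes f g :: "'a::real_normed_vector \<Rightarrow> real"
  shows "open S \<Longrightarrow> smooth_on S f \<Longrightarrow> smooth_on S g \<Longrightarrow> smooth_on S (\<lambda>x. f x * g x)"
  unfolding smooth_on_def real_scaleR_def[symmetric] by (intro allI Ck_on_scaleR) simp_all

lemma smooth_on_compose:
  fixes g :: "'c::real_normed_vector \<Rightarrow> 'd::euclidean_space"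
  shows "open S \<Longrightarrow> open T \<Longrightarrow> g ` S \<subseteq> T \<Longrightarrow> smooth_on T f \<Longrightarrow> smooth_on S g
    \<Longrightarrow> smooth_on S (\<lambda>x. f (g x))"
  unfolding smooth_on_def by (rule allI, rule Ck_on_compose[of S T g]) simp_all

lemma smooth_on_bounded_linear: "bounded_linear L \<Longrightarrow> smooth_on S L"
proof -
  assume L: "bounded_linear L"
  have "Ck_on k UNIV L" for k
  proof (cases k)
    case 0
    then show ?thesis using linear_continuous_on[OF L] by simp
  next
    case (Suc m)
    have "Ck_on (Suc m) UNIV L"
      by (rule Ck_on_SucI[OF open_UNIV bounded_linear_imp_has_derivative[OF L] Ck_on_const])
    then show ?thesis using Suc by simp
  qed
  then show ?thesis unfolding smooth_on_def using Ck_on_subset by blast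
qed

lemma smooth_on_has_derivative:
  "smooth_on S f \<Longrightarrow> x \<in> S \<Longrightarrow> (f has_derivative frechet_derivative f (at x)) (at x)"
  unfolding smooth_on_def by (rule Ck_on_Suc_has_derivative[where k = 0]) auto

lemma smooth_on_frechet_derivative:
  "smooth_on S f \<Longrightarrow> smooth_on S (\<lambda>x. frechet_derivative f (at x) v)"
  unfolding smooth_on_def
proof
  fix k assume "\<forall>k. Ck_on k S f"
  then have "Ck_on (Suc k) S f" ..
  then show "Ck_on k S (\<lambda>x. frechet_derivative f (at x) v)" by simp
qed

section \<open>Bump functions\<close>

text \<open>The family over all polynomials is closed under differentiation.\<close>

definition flat_exp :: "real poly \<Rightarrow> real \<Rightarrow> real"
  where "flat_exp P t = (if t \<le> 0 then 0 else poly P (1 / t) * exp (- (1 / t)))"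

text \<open>Read with \<open>x = 1 / t\<close>, this is the flatness of every
  \<open>flat_exp P\<close> at 0 from the right.\<close>

lemma tendsto_poly_exp_neg: "((\<lambda>x::real. poly P x * exp (- x)) \<longlongrightarrow> 0) at_top"
proof -
  have "((\<lambda>x::real. \<Sum>i\<le>degree P. coeff P i * (x ^ i / exp x)) \<longlongrightarrow> (\<Sum>i\<le>degree P. coeff P i * 0)) at_top"
    by (rule tendsto_sum, rule tendsto_mult[OF tendsto_const tendsto_power_div_exp_0])
  moreover have "(\<lambda>x::real. \<Sum>i\<le>degree P. coeff P i * (x ^ i / exp x)) = (\<lambda>x. poly P x * exp (- x))"
    by (auto simp: poly_altdef sum_distrib_right exp_minus divide_inverse mult.assoc)
  ultimately show ?thesis by simp
qed

lemma flat_exp_has_derivative_0: "(flat_exp P has_real_derivative 0) (at 0)"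
proof -
  have "((\<lambda>t. flat_exp P t / t) \<longlongrightarrow> 0) (at_right 0)"
  proof -
    \<comment> \<open>Dividing by \<open>t\<close> multiplies the polynomial in \<open>1 / t\<close>
      by its variable, hence \<open>pCons 0 P\<close>.\<close>
    have "((\<lambda>t. poly (pCons 0 P) (inverse t) * exp (- (inverse t))) \<longlongrightarrow> 0) (at_right (0::real))"
      by (rule filterlim_compose[OF tendsto_poly_exp_neg filterlim_inverse_at_top_right])
    then show ?thesis
      by (rule Lim_transform_eventually)
        (auto simp: flat_exp_def eventually_at_filter inverse_eq_divide)
  qed
  moreover have "((\<lambda>t. flat_exp P t / t) \<longlongrightarrow> 0) (at_left 0)"
    by (rule Lim_transform_eventually[OF tendsto_const])
      (auto simp: flat_exp_def eventually_at_filter)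
  ultimately show ?thesis
    by (simp add: has_field_derivative_iff filterlim_split_at flat_exp_def)
qed

text \<open>With s = 1/t one has d/dt = -s^2 d/ds, and -s^2 times the s-derivative of P(s) exp(-s)
  is s^2 (P - P')(s) exp(-s); this is the origin of the polynomial.\<close>

lemma flat_exp_has_derivative:
  "(flat_exp P has_real_derivative flat_exp (monom 1 2 * (P - pderiv P)) t) (at t)"
proof -
  consider "t < 0" | "t = 0" | "t > 0" by linarith
  then show ?thesis
  proof cases
    case 1
    have "((\<lambda>_. 0) has_real_derivative 0) (at t)" by simp
    then have "(flat_exp P has_real_derivative 0) (at t)"
      by (rule has_field_derivative_transform_within_open[of _ _ _ "{..<0}"])
        (use 1 in \<open>auto simp: flat_exp_def\<close>)
    then show ?thesis using 1 by (simp add: flat_exp_def)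
  next
    case 2
    then show ?thesis using flat_exp_has_derivative_0[of P] by (simp add: flat_exp_def)
  next
    case 3
    have i: "((\<lambda>t. 1 / t) has_real_derivative - (1 / t)\<^sup>2) (at t)"
      using 3 by (auto intro!: derivative_eq_intros simp: power2_eq_square)
    have "((\<lambda>t. poly P (1 / t) * exp (- (1 / t))) has_real_derivative
        poly (monom 1 2 * (P - pderiv P)) (1 / t) * exp (- (1 / t))) (at t)"
      by (rule DERIV_cong[OF DERIV_mult[OF DERIV_chain2[OF poly_DERIV i]
            DERIV_fun_exp[OF DERIV_minus[OF i]]]])
        (simp add: poly_monom algebra_simps)
    then have "(flat_exp P has_real_derivative
        poly (monom 1 2 * (P - pderiv P)) (1 / t) * exp (- (1 / t))) (at t)"
      by (rule has_field_derivative_transform_within_open[of _ _ _ "{0<..}"])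
        (use 3 in \<open>auto simp: flat_exp_def\<close>)
    then show ?thesis using 3 by (simp add: flat_exp_def)
  qed
qed

lemma smooth_on_flat_exp: "smooth_on UNIV (flat_exp P)"
proof -
  have "Ck_on k UNIV (flat_exp P)" for k
  proof (induction k arbitrary: P)
    case 0
    show ?case
      by (auto intro!: continuous_at_imp_continuous_on DERIV_isCont[OF flat_exp_has_derivative])
  next
    case (Suc k)
    let ?Q = "monom 1 2 * (P - pderiv P)"
    show ?case
    proof (rule Ck_on_SucI)
      show "(flat_exp P has_derivative (\<lambda>v. flat_exp ?Q x * v)) (at x)" for x
        using flat_exp_has_derivative[of P x] by (simp add: has_field_derivative_def)
      show "Ck_on k UNIV (\<lambda>x. flat_exp ?Q x * v)" for v
        using Ck_on_bounded_linear[OF open_UNIV bounded_linear_mult_left Suc.IH] .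
    qed simp
  qed
  then show ?thesis by (simp add: smooth_on_def)
qed

text \<open>The squared distance makes the argument a polynomial in the coordinates, so that the
  function is smooth at its centre as well; for positive \<open>r\<close> it is nonzero exactly on
  the open ball.\<close>

definition bump :: "'e::euclidean_space \<Rightarrow> real \<Rightarrow> 'e \<Rightarrow> real"
  where "bump a r x = flat_exp 1 (r\<^sup>2 - (dist x a)\<^sup>2)"

lemma smooth_on_bump: "smooth_on S (bump a r)"
proof -
  have inner: "smooth_on UNIV (\<lambda>x. x \<bullet> b)" for b :: 'a
    by (rule smooth_on_bounded_linear[OF bounded_linear_inner_left])
  have d: "r\<^sup>2 - (dist x a)\<^sup>2
      = (r\<^sup>2 - a \<bullet> a) + (2 * (x \<bullet> a) + (-1) * (\<Sum>b\<in>Basis. (x \<bullet> b) * (x \<bullet> b)))" for x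
  proof -
    have "(dist x a)\<^sup>2 = x \<bullet> x - 2 * (x \<bullet> a) + a \<bullet> a"
      by (simp add: dist_norm power2_norm_eq_inner inner_diff inner_commute)
    then show ?thesis unfolding euclidean_inner[of x x] by linarith
  qed
  have sum: "smooth_on UNIV (\<lambda>x::'a. \<Sum>b\<in>Basis. (x \<bullet> b) * (x \<bullet> b))"
    unfolding smooth_on_def
  proof (intro allI Ck_on_sum[OF open_UNIV])
    show "Ck_on k UNIV (\<lambda>x::'a. (x \<bullet> b) * (x \<bullet> b))" for k b
      using smooth_on_mult[OF open_UNIV inner inner, of b b] by (simp add: smooth_on_def)
  qed
  have "smooth_on UNIV (\<lambda>x. r\<^sup>2 - (dist x a)\<^sup>2)"
    unfolding d
    by (rule smooth_on_add[OF open_UNIV smooth_on_const smooth_on_add[OF open_UNIV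
          smooth_on_mult[OF open_UNIV smooth_on_const inner]
          smooth_on_mult[OF open_UNIV smooth_on_const sum]]])
  then have "smooth_on UNIV (\<lambda>x. flat_exp 1 (r\<^sup>2 - (dist x a)\<^sup>2))"
    by (rule smooth_on_compose[OF open_UNIV open_UNIV subset_UNIV smooth_on_flat_exp])
  then show ?thesis unfolding bump_def[abs_def] by (rule smooth_on_subset) simp
qed

lemma bump_eq_0: "0 \<le> r \<Longrightarrow> r \<le> dist x a \<Longrightarrow> bump a r x = 0"
  by (simp add: bump_def flat_exp_def power_mono)

lemma bump_center: "0 < r \<Longrightarrow> bump a r a \<noteq> 0"
  by (simp add: bump_def flat_exp_def)

section \<open>Smooth functions and vector fields\<close>

lemma tangent_space_subspace: "subspace (tangent_space A p)"
  by (rule subspaceI) (auto simp: tangent_space_def scaleR_fun_def algebra_simps)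

lemma tangent_vector_not_smooth:
  "v \<in> tangent_space A p \<Longrightarrow> f \<notin> smooth_functions A \<Longrightarrow> v f = 0"
  by (simp add: tangent_space_def)

lemma chart_left_inverse: "chart U c \<Longrightarrow> q \<in> U \<Longrightarrow> inv_into U c (c q) = q"
  by (simp add: chart_def homeomorphism_def)

lemma chart_open_image:
  assumes "chart U c" "open W" "W \<subseteq> U"
  shows "open (c ` W)"
proof -
  have "openin (top_of_set (c ` U)) (c ` W)"
    using assms by (intro homeomorphism_imp_open_map) (auto simp: chart_def open_subset)
  then show ?thesis using assms(1) by (auto simp: chart_def openin_open_eq)
qed

text \<open>The partial derivative in direction \<open>b\<close>, cut off by \<open>\<beta>\<close>.
  The value 0 outside \<open>U\<close> makes it a global field, and the value 0 on non-smooth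
  functions is the normalisation that \<open>tangent_space\<close> demands.\<close>

definition coordinate_field ::
  "('a::topological_space, 'e::euclidean_space) atlas \<Rightarrow> 'a set \<Rightarrow> ('a \<Rightarrow> 'e) \<Rightarrow> ('e \<Rightarrow> real) \<Rightarrow> 'e
     \<Rightarrow> 'a vector_field"
  where "coordinate_field A U c \<beta> b = (\<lambda>q f. if q \<in> U \<and> f \<in> smooth_functions A
    then \<beta> (c q) * frechet_derivative (f \<circ> inv_into U c) (at (c q)) b else 0)"

locale smooth_manifold =
  fixes A :: "('a::t2_space, 'e::euclidean_space) atlas"
  assumes smooth_atlas: "smooth_atlas A"
begin

lemma chart: "(U, c) \<in> A \<Longrightarrow> chart U c"
  using smooth_atlas by (auto simp: smooth_atlas_def)

lemma open_chart_range: "(U, c) \<in> A \<Longrightarrow> open (c ` U)"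
  using chart by (auto simp: chart_def)

lemma smooth_transition:
  "(U, c) \<in> A \<Longrightarrow> (V, d) \<in> A \<Longrightarrow> smooth_on (d ` (V \<inter> U)) (c \<circ> inv_into V d)"
  using smooth_atlas unfolding smooth_atlas_def by blast

lemma smooth_function_in_chart:
  "f \<in> smooth_functions A \<Longrightarrow> (U, c) \<in> A \<Longrightarrow> smooth_on (c ` U) (f \<circ> inv_into U c)"
  by (auto simp: smooth_functions_def)

lemma smooth_functions_const: "(\<lambda>_. r) \<in> smooth_functions A"
  by (auto simp: smooth_functions_def comp_def smooth_on_const)

lemma smooth_functions_add':
  assumes "f \<in> smooth_functions A" "g \<in> smooth_functions A"
  shows "(\<lambda>q. f q + g q) \<in> smooth_functions A"
  unfolding smooth_functions_def
proof clarify
  fix U c assume "(U, c) \<in> A"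
  then show "smooth_on (c ` U) ((\<lambda>q. f q + g q) \<circ> inv_into U c)"
    using smooth_on_add[OF open_chart_range smooth_function_in_chart
        smooth_function_in_chart, of U c f g]
      assms by (simp add: comp_def)
qed

lemma smooth_functions_mult:
  assumes "f \<in> smooth_functions A" "g \<in> smooth_functions A"
  shows "(\<lambda>q. f q * g q) \<in> smooth_functions A"
  unfolding smooth_functions_def
proof clarify
  fix U c assume "(U, c) \<in> A"
  then show "smooth_on (c ` U) ((\<lambda>q. f q * g q) \<circ> inv_into U c)"
    using smooth_on_mult[OF open_chart_range smooth_function_in_chart
        smooth_function_in_chart, of U c f g]
      assms by (simp add: comp_def)
qed

lemma smooth_functions_add:
  "f \<in> smooth_functions A \<Longrightarrow> g \<in> smooth_functions A \<Longrightarrow> f + g \<in> smooth_functions A"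
  using smooth_functions_add' by (simp add: plus_fun_def)

lemma smooth_functions_scale:
  "f \<in> smooth_functions A \<Longrightarrow> (\<lambda>q. r * f q) \<in> smooth_functions A"
  by (rule smooth_functions_mult[OF smooth_functions_const])

text \<open>In another chart the domain is covered by two open sets: on the overlap with
  \<open>U\<close> the function is a composite with the transition map, and off the support it is 0.
  The second set is open because the support is compact and the manifold is Hausdorff.\<close>

lemma smooth_functions_extend_by_zero:
  assumes UA: "(U, c) \<in> A" and \<phi>: "smooth_on (c ` U) \<phi>" and sub: "cball a r \<subseteq> c ` U"
    and supp: "\<And>x. x \<notin> cball a r \<Longrightarrow> \<phi> x = 0"
  shows "(\<lambda>q. if q \<in> U then \<phi> (c q) else 0) \<in> smooth_functions A"
  unfolding smooth_functions_def
proof clarify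
  fix V d assume VA: "(V, d) \<in> A"
  let ?F = "\<lambda>q. if q \<in> U then \<phi> (c q) else 0"
  let ?K = "inv_into U c ` cball a r"
  have U: "chart U c" and V: "chart V d" using chart UA VA by auto
  have "continuous_on (cball a r) (inv_into U c)"
    by (rule continuous_on_subset[OF _ sub]) (use U in \<open>simp add: chart_def homeomorphism_def\<close>)
  then have K: "closed ?K"
    using compact_imp_closed[OF compact_continuous_image] compact_cball by blast
  have o1: "open (d ` (V \<inter> U))" and o2: "open (d ` (V - ?K))"
    using chart_open_image[OF V, of "V \<inter> U"] chart_open_image[OF V, of "V - ?K"] U V K
    by (simp_all add: chart_def open_Int open_Diff)
  have "?K \<subseteq> U" using sub inv_into_into[of _ c U] by auto
  then have cover: "d ` V = d ` (V \<inter> U) \<union> d ` (V - ?K)" by blast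
  have "smooth_on (d ` (V \<inter> U)) (?F \<circ> inv_into V d)"
  proof -
    have "smooth_on (d ` (V \<inter> U)) (\<lambda>x. \<phi> ((c \<circ> inv_into V d) x))"
    proof (rule smooth_on_compose[OF o1 open_chart_range[OF UA] _ \<phi> smooth_transition[OF UA VA]])
      show "(c \<circ> inv_into V d) ` (d ` (V \<inter> U)) \<subseteq> c ` U"
        using chart_left_inverse[OF V] by auto
    qed
    then show ?thesis
      by (subst smooth_on_cong[OF o1, where g = "\<lambda>x. \<phi> ((c \<circ> inv_into V d) x)"])
        (auto simp: chart_left_inverse[OF V])
  qed
  moreover have "smooth_on (d ` (V - ?K)) (?F \<circ> inv_into V d)"
  proof (subst smooth_on_cong[OF o2, where g = "\<lambda>_. 0"])
    fix x assume "x \<in> d ` (V - ?K)"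
    then obtain q where q: "q \<in> V" "q \<notin> ?K" "x = d q" by auto
    have "\<phi> (c q) = 0" if "q \<in> U"
    proof (rule supp)
      show "c q \<notin> cball a r"
        using q(2) imageI[of "c q" "cball a r" "inv_into U c"] chart_left_inverse[OF U that] by auto
    qed
    then show "(?F \<circ> inv_into V d) x = 0" using chart_left_inverse[OF V q(1)] q(3) by simp
  qed (rule smooth_on_const)
  ultimately show "smooth_on (d ` V) (?F \<circ> inv_into V d)"
    unfolding cover by (rule smooth_on_Un[OF o1 o2])
qed

section \<open>Global vector fields and their values at a point\<close>

lemma vector_field_tangent: "X \<in> vector_fields A \<Longrightarrow> X p \<in> tangent_space A p"
  by (simp add: vector_fields_def)

lemma lie_action_smooth:
  "X \<in> vector_fields A \<Longrightarrow> f \<in> smooth_functions A \<Longrightarrow> lie_action X f \<in> smooth_functions A"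
  by (simp add: vector_fields_def)

lemma vector_fields_fmult:
  assumes "f \<in> smooth_functions A" "X \<in> vector_fields A"
  shows "fmult f X \<in> vector_fields A"
proof -
  have "lie_action (fmult f X) g = (\<lambda>q. f q * lie_action X g q)" for g
    by (simp add: lie_action_def fmult_def scaleR_fun_def)
  then show ?thesis
    using assms smooth_functions_mult
    by (auto simp: vector_fields_def fmult_def intro: subspace_scale[OF tangent_space_subspace])
qed

lemma vector_fields_add:
  assumes "X \<in> vector_fields A" "Y \<in> vector_fields A"
  shows "X + Y \<in> vector_fields A"
proof -
  have "lie_action (X + Y) g = lie_action X g + lie_action Y g" for g
    by (simp add: lie_action_def fun_eq_iff)
  then show ?thesis
    using assms smooth_functions_add
    by (auto simp: vector_fields_def intro: subspace_add[OF tangent_space_subspace])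
qed

lemma vector_fields_subspace: "subspace (vector_fields A)"
proof (rule subspaceI)
  show "0 \<in> vector_fields A"
    using smooth_functions_const[of 0] subspace_0[OF tangent_space_subspace]
    by (auto simp: vector_fields_def lie_action_def zero_fun_def)
  fix X :: "'a vector_field" and r :: real assume X: "X \<in> vector_fields A"
  have "r *\<^sub>R X = fmult (\<lambda>_. r) X" by (simp add: scaleR_fun_def fmult_def)
  then show "r *\<^sub>R X \<in> vector_fields A"
    using vector_fields_fmult[OF smooth_functions_const X] by simp
qed (rule vector_fields_add)

lemma coordinate_field:
  assumes UA: "(U, c) \<in> A" and \<beta>: "smooth_on (c ` U) \<beta>" and sub: "cball a r \<subseteq> c ` U"
    and supp: "\<And>x. x \<notin> cball a r \<Longrightarrow> \<beta> x = 0"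
  shows "coordinate_field A U c \<beta> b \<in> vector_fields A"
  unfolding vector_fields_def
proof (intro CollectI conjI allI ballI)
  let ?X = "coordinate_field A U c \<beta> b"
  let ?D = "\<lambda>f x. frechet_derivative (f \<circ> inv_into U c) (at x)"
  note U = chart[OF UA]
  fix q
  show "?X q \<in> tangent_space A q"
  proof (cases "q \<in> U")
    case False
    then have "?X q = 0" by (simp add: coordinate_field_def fun_eq_iff)
    then show ?thesis using subspace_0[OF tangent_space_subspace] by simp
  next
    case True
    have D: "(f \<circ> inv_into U c has_derivative ?D f (c q)) (at (c q))"
      if "f \<in> smooth_functions A" for f
      using smooth_on_has_derivative[OF smooth_function_in_chart[OF that UA]] True by blast
    have add: "?D (\<lambda>q. f q + g q) (c q) b = ?D f (c q) b + ?D g (c q) b"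
      and mult: "?D (\<lambda>q. f q * g q) (c q) b = ?D f (c q) b * g q + f q * ?D g (c q) b"
      if "f \<in> smooth_functions A" "g \<in> smooth_functions A" for f g
    proof -
      show "?D (\<lambda>q. f q + g q) (c q) b = ?D f (c q) b + ?D g (c q) b"
        using fun_cong[OF frechet_derivative_at[OF has_derivative_add[OF D[OF that(1)]
              D[OF that(2)]]], of b]
        by (simp add: comp_def)
      show "?D (\<lambda>q. f q * g q) (c q) b = ?D f (c q) b * g q + f q * ?D g (c q) b"
        using fun_cong[OF frechet_derivative_at[OF has_derivative_mult[OF D[OF that(1)]
              D[OF that(2)]]], of b]
        by (simp add: comp_def chart_left_inverse[OF U True])
    qed
    have scale: "?D (\<lambda>q. s * f q) (c q) b = s * ?D f (c q) b"
      if "f \<in> smooth_functions A" for f s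
      using fun_cong[OF frechet_derivative_at[OF has_derivative_mult_right[OF D[OF that],
            of s]], of b]
      by (simp add: comp_def)
    show ?thesis
      unfolding tangent_space_def
      using True
      by (auto simp: coordinate_field_def add mult scale smooth_functions_add'
          smooth_functions_mult smooth_functions_scale algebra_simps)
  qed
next
  fix f assume f: "f \<in> smooth_functions A"
  let ?\<phi> = "\<lambda>x. \<beta> x * frechet_derivative (f \<circ> inv_into U c) (at x) b"
  have "lie_action (coordinate_field A U c \<beta> b) f = (\<lambda>q. if q \<in> U then ?\<phi> (c q) else 0)"
    using f by (auto simp: lie_action_def coordinate_field_def)
  moreover have "smooth_on (c ` U) ?\<phi>"
    using smooth_on_mult[OF open_chart_range[OF UA] \<beta>
        smooth_on_frechet_derivative[OF smooth_function_in_chart[OF f UA]]] .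
  ultimately show "lie_action (coordinate_field A U c \<beta> b) f \<in> smooth_functions A"
    using smooth_functions_extend_by_zero[OF UA, of ?\<phi> a r] sub supp by simp
qed

text \<open>
  The coordinate fields at \<open>p\<close> are separated by the (cut off) coordinate functions, so they are
  independent, and the bound on the dimension makes them span.
\<close>

lemma tangent_vector_extends:
  assumes fin: "finite S" and card: "card S \<le> DIM('e)" and span: "tangent_space A p \<subseteq> span S"
    and v: "v \<in> tangent_space A p"
  shows "\<exists>X\<in>vector_fields A. X p = v"
proof -
  obtain U c where UA: "(U, c) \<in> A" and pU: "p \<in> U"
  proof -
    have "p \<in> (\<Union>(U, c)\<in>A. U)" using smooth_atlas by (simp add: smooth_atlas_def)
    then show ?thesis using that by auto
  qed
  note U = chart[OF UA]
  let ?a = "c p"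
  obtain r where r: "0 < r" and sub: "cball ?a r \<subseteq> c ` U"
    using open_chart_range[OF UA] pU open_contains_cball by blast
  let ?\<beta> = "bump ?a r"
  have supp: "?\<beta> x = 0" if "x \<notin> cball ?a r" for x
    using that r by (intro bump_eq_0) (auto simp: dist_commute)
  let ?X = "coordinate_field A U c ?\<beta>"
  let ?e = "\<lambda>b. ?X b p"
  have X: "?X b \<in> vector_fields A" for b
    by (rule coordinate_field[OF UA smooth_on_bump sub supp])
  define f where "f b q = (if q \<in> U then ?\<beta> (c q) * ((c q - ?a) \<bullet> b) else 0)" for b q
  have coord: "smooth_on S (\<lambda>x. (x - ?a) \<bullet> b)" if "open S" for S b
  proof -
    have "smooth_on S (\<lambda>x. x \<bullet> b + (- (?a \<bullet> b)))"
      by (intro smooth_on_add that smooth_on_const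
          smooth_on_bounded_linear[OF bounded_linear_inner_left])
    then show ?thesis by (simp add: inner_diff_left)
  qed
  have f: "f b \<in> smooth_functions A" for b
    using smooth_functions_extend_by_zero[OF UA smooth_on_mult[OF _ smooth_on_bump coord] sub]
      open_chart_range[OF UA] supp by (simp add: f_def[abs_def])
  \<comment> \<open>At \<open>?a\<close> the factor \<open>x - ?a\<close> vanishes, so the product
    rule keeps only the term with \<open>?\<beta> ?a\<close> undifferentiated. The second factor
    \<open>?\<beta> ?a\<close> is the cut-off of the field.\<close>
  have ef: "?e i (f j) = (?\<beta> ?a)\<^sup>2 * (i \<bullet> j)" for i j
  proof -
    have \<beta>: "(?\<beta> has_derivative frechet_derivative ?\<beta> (at ?a)) (at ?a)"
      by (rule smooth_on_has_derivative[OF smooth_on_bump UNIV_I])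
    have "((\<lambda>x. ?\<beta> x * ((x - ?a) \<bullet> j)) has_derivative (\<lambda>h. ?\<beta> ?a * (h \<bullet> j))) (at ?a)"
      by (rule has_derivative_eq_rhs[OF has_derivative_mult[OF \<beta>]])
        (auto intro!: derivative_eq_intros)
    then have "(f j \<circ> inv_into U c has_derivative (\<lambda>h. ?\<beta> ?a * (h \<bullet> j))) (at ?a)"
      by (rule has_derivative_transform_within_open[OF _ open_chart_range[OF UA]])
        (auto simp: pU f_def chart_left_inverse[OF U])
    then show ?thesis
      using f[of j] pU
      by (simp add: coordinate_field_def power2_eq_square flip: frechet_derivative_at)
  qed
  have nz: "?\<beta> ?a \<noteq> 0" using bump_center[OF r] .
  have inj: "inj_on ?e Basis"
  proof (rule inj_onI)
    fix i j :: 'e assume ij: "i \<in> Basis" "j \<in> Basis" and "?e i = ?e j"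
    then have "?e i (f i) = ?e j (f i)" by simp
    then show "i = j" using ij nz by (auto simp: ef inner_Basis split: if_splits)
  qed
  let ?B = "?e ` Basis"
  have "independent ?B"
    unfolding dependent_def
  proof clarsimp
    fix i :: 'e assume i: "i \<in> Basis" and dep: "?e i \<in> span (?B - {?e i})"
    have "span (?B - {?e i}) \<subseteq> {w. w (f i) = 0}"
    proof (rule span_minimal)
      show "?B - {?e i} \<subseteq> {w. w (f i) = 0}" using i by (auto simp: ef inner_Basis)
      show "subspace {w. w (f i) = 0}" by (rule subspaceI) (auto simp: scaleR_fun_def)
    qed
    then show False using dep i nz ef[of i i] by (auto simp: inner_Basis)
  qed
  then have "v \<in> span ?B"
  proof (rule contrapos_pp)
    assume nv: "v \<notin> span ?B"
    then have "v \<notin> ?B" using span_base[of v ?B] by argo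
    then have "card (insert v ?B) = Suc (DIM('e))" using card_image[OF inj] by simp
    moreover have "insert v ?B \<subseteq> span S"
      using subsetD[OF span v] subsetD[OF span vector_field_tangent[OF X]] by auto
    ultimately have "\<not> independent (insert v ?B)"
      using independent_span_bound[OF fin, of "insert v ?B"] card by linarith
    then show "\<not> independent ?B" using independent_insertI[OF nv] by argo
  qed
  moreover have "span ?B \<subseteq> {X p |X. X \<in> vector_fields A}"
  proof (rule span_minimal)
    have "{X p |X. X \<in> vector_fields A} = (\<lambda>X. X p) ` vector_fields A" by blast
    moreover have "linear (\<lambda>X :: 'a vector_field. X p)"
      by (rule linearI) (simp_all add: scaleR_fun_def)
    ultimately show "subspace {X p |X. X \<in> vector_fields A}"
      using linear_subspace_image[OF _ vector_fields_subspace] by simp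
  qed (use X in blast)
  ultimately show ?thesis by blast
qed

end

section \<open>The Levi-Civita connection\<close>

context smooth_manifold
begin

lemma vector_fields_diff:
  "X \<in> vector_fields A \<Longrightarrow> Y \<in> vector_fields A \<Longrightarrow> X - Y \<in> vector_fields A"
  by (rule subspace_diff[OF vector_fields_subspace])

lemma vector_fields_minus: "X \<in> vector_fields A \<Longrightarrow> - X \<in> vector_fields A"
  by (rule subspace_neg[OF vector_fields_subspace])

lemma vector_fields_scaleR: "X \<in> vector_fields A \<Longrightarrow> r *\<^sub>R X \<in> vector_fields A"
  by (rule subspace_scale[OF vector_fields_subspace])

lemma lie_action_add:
  "X \<in> vector_fields A \<Longrightarrow> f \<in> smooth_functions A \<Longrightarrow> g \<in> smooth_functions A
    \<Longrightarrow> lie_action X (\<lambda>q. f q + g q) p = lie_action X f p + lie_action X g p"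
  using vector_field_tangent[of X p] by (simp add: lie_action_def tangent_space_def)

lemma lie_action_scale:
  "X \<in> vector_fields A \<Longrightarrow> f \<in> smooth_functions A
    \<Longrightarrow> lie_action X (\<lambda>q. r * f q) p = r * lie_action X f p"
  using vector_field_tangent[of X p] by (simp add: lie_action_def tangent_space_def)

lemma lie_action_diff:
  "X \<in> vector_fields A \<Longrightarrow> f \<in> smooth_functions A \<Longrightarrow> g \<in> smooth_functions A
    \<Longrightarrow> lie_action X (\<lambda>q. f q - g q) p = lie_action X f p - lie_action X g p"
  using lie_action_add[of X f "\<lambda>q. (-1) * g q" p] lie_action_scale[of X g "-1" p]
    smooth_functions_scale[of g "-1"] by simp

lemma lie_action_const:
  assumes "X \<in> vector_fields A"
  shows "lie_action X (\<lambda>_. r) p = 0"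
proof -
  have "X p (\<lambda>q. 1 * 1) = X p (\<lambda>_. 1) * 1 + 1 * X p (\<lambda>_. 1)"
    using vector_field_tangent[OF assms, of p] smooth_functions_const[of 1]
    unfolding tangent_space_def by fast
  then have "lie_action X (\<lambda>_. 1) p = 0" by (simp add: lie_action_def)
  then show ?thesis using lie_action_scale[OF assms smooth_functions_const, of r 1 p] by simp
qed

end

lemma lie_action_bracket:
  "lie_action (bracket X Y) f p = lie_action X (lie_action Y f) p - lie_action Y (lie_action X f) p"
  by (simp add: lie_action_def bracket_def)

locale levi_civita = smooth_manifold A
  for A :: "('a::t2_space, 'e::euclidean_space) atlas" +
  fixes g :: "'a \<Rightarrow> 'a tangent_vector \<Rightarrow> 'a tangent_vector \<Rightarrow> real"
    and nabla :: "'a vector_field \<Rightarrow> 'a vector_field \<Rightarrow> 'a vector_field"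
  assumes metric: "pseudo_riemannian_metric A g"
    and levi_civita: "levi_civita_connection A g nabla"
begin

abbreviation VF :: "'a vector_field set" where "VF \<equiv> vector_fields A"
abbreviation G :: "'a vector_field \<Rightarrow> 'a vector_field \<Rightarrow> 'a \<Rightarrow> real" where "G \<equiv> app2 g"

lemma nabla_closed: "X \<in> VF \<Longrightarrow> Y \<in> VF \<Longrightarrow> nabla X Y \<in> VF"
  using levi_civita by (simp add: levi_civita_connection_def affine_connection_def)

lemma nabla_add:
  assumes "X \<in> VF" "Y \<in> VF" "Z \<in> VF"
  shows nabla_add_left: "nabla (X + Y) Z = nabla X Z + nabla Y Z"
    and nabla_add_right: "nabla X (Y + Z) = nabla X Y + nabla X Z"
  using levi_civita assms by (simp_all add: levi_civita_connection_def affine_connection_def)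

lemma nabla_diff:
  assumes "X \<in> VF" "Y \<in> VF" "Z \<in> VF"
  shows nabla_diff_left: "nabla (X - Y) Z = nabla X Z - nabla Y Z"
    and nabla_diff_right: "nabla X (Y - Z) = nabla X Y - nabla X Z"
  using nabla_add_left[of "X - Y" Y Z] nabla_add_right[of X "Y - Z" Z] assms vector_fields_diff
  by (simp_all add: algebra_simps)

lemma nabla_fmult:
  "f \<in> smooth_functions A \<Longrightarrow> X \<in> VF \<Longrightarrow> Y \<in> VF
    \<Longrightarrow> nabla X (fmult f Y) = fmult (lie_action X f) Y + fmult f (nabla X Y)"
  using levi_civita by (simp add: levi_civita_connection_def affine_connection_def)

lemma bracket_nabla: "X \<in> VF \<Longrightarrow> Y \<in> VF \<Longrightarrow> bracket X Y = nabla X Y - nabla Y X"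
  using levi_civita by (simp add: levi_civita_connection_def)

lemma bracket_closed: "X \<in> VF \<Longrightarrow> Y \<in> VF \<Longrightarrow> bracket X Y \<in> VF"
  by (simp add: bracket_nabla nabla_closed vector_fields_diff)

lemma metric_smooth: "X \<in> VF \<Longrightarrow> Y \<in> VF \<Longrightarrow> G X Y \<in> smooth_functions A"
  using metric by (simp add: pseudo_riemannian_metric_def)

lemma metric_sym: "X \<in> VF \<Longrightarrow> Y \<in> VF \<Longrightarrow> G X Y p = G Y X p"
  using metric vector_field_tangent by (simp add: pseudo_riemannian_metric_def app2_def)

lemma metric_linear: "X \<in> VF \<Longrightarrow> linear_from (tangent_space A p) (g p (X p))"
  using metric vector_field_tangent by (simp add: pseudo_riemannian_metric_def)

lemma metric_add_right: "X \<in> VF \<Longrightarrow> Y \<in> VF \<Longrightarrow> Z \<in> VF \<Longrightarrow> G X (Y + Z) p = G X Y p + G X Z p"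
  using metric_linear[of X p] vector_field_tangent by (simp add: linear_from_def app2_def)

lemma metric_add_left: "X \<in> VF \<Longrightarrow> Y \<in> VF \<Longrightarrow> Z \<in> VF \<Longrightarrow> G (Y + Z) X p = G Y X p + G Z X p"
  by (simp add: metric_sym[of _ X] metric_add_right vector_fields_add)

lemma metric_diff_right: "X \<in> VF \<Longrightarrow> Y \<in> VF \<Longrightarrow> Z \<in> VF \<Longrightarrow> G X (Y - Z) p = G X Y p - G X Z p"
  using metric_add_right[of X "Y - Z" Z p] by (simp add: vector_fields_diff)

lemma metric_diff_left: "X \<in> VF \<Longrightarrow> Y \<in> VF \<Longrightarrow> Z \<in> VF \<Longrightarrow> G (Y - Z) X p = G Y X p - G Z X p"
  by (simp add: metric_sym[of _ X] metric_diff_right vector_fields_diff)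

lemma metric_fmult_right: "X \<in> VF \<Longrightarrow> Y \<in> VF \<Longrightarrow> G X (fmult f Y) p = f p * G X Y p"
  using metric_linear[of X p] vector_field_tangent
  by (simp add: linear_from_def app2_def fmult_def)

lemma metric_scaleR_right: "X \<in> VF \<Longrightarrow> Y \<in> VF \<Longrightarrow> G X (r *\<^sub>R Y) p = r * G X Y p"
  using metric_linear[of X p] vector_field_tangent
  by (simp add: linear_from_def app2_def scaleR_fun_def[of _ Y])

lemma metric_scaleR_left: "X \<in> VF \<Longrightarrow> Y \<in> VF \<Longrightarrow> G (r *\<^sub>R Y) X p = r * G Y X p"
  by (simp add: metric_sym[of _ X] metric_scaleR_right vector_fields_scaleR)

lemma metric_minus_right: "X \<in> VF \<Longrightarrow> Y \<in> VF \<Longrightarrow> G X (- Y) p = - G X Y p"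
  using metric_scaleR_right[of X Y "-1" p] by simp

lemma metric_minus_left: "X \<in> VF \<Longrightarrow> Y \<in> VF \<Longrightarrow> G (- Y) X p = - G Y X p"
  using metric_scaleR_left[of X Y "-1" p] by simp

lemmas field_closed = vector_fields_add vector_fields_diff vector_fields_minus vector_fields_scaleR
  nabla_closed bracket_closed

lemmas metric_bilinear = metric_add_right metric_add_left metric_diff_right metric_diff_left
  metric_minus_right metric_minus_left metric_scaleR_right metric_scaleR_left

lemma lie_action_metric:
  assumes "X \<in> VF" "Y \<in> VF" "Z \<in> VF"
  shows "lie_action X (G Y Z) = (\<lambda>p. G (nabla X Y) Z p + G Y (nabla X Z) p)"
  using levi_civita assms by (simp add: levi_civita_connection_def plus_fun_def)

text \<open>Stands in for \<open>nabla X 0 = 0\<close> when \<open>V\<close> is known only to be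
  orthogonal to every field, as \<open>nabla \<xi> \<xi>\<close> will be: differentiate the constant
  function \<open>G V W\<close>; the term with the derivative on \<open>W\<close> is again a pairing
  with \<open>V\<close>.\<close>

lemma nabla_weak_zero:
  assumes "X \<in> VF" "V \<in> VF" "W \<in> VF" "\<And>Z p. Z \<in> VF \<Longrightarrow> G V Z p = 0"
  shows "G (nabla X V) W p = 0"
proof -
  have "G V W = (\<lambda>_. 0)" using assms by auto
  then have "lie_action X (G V W) p = 0" using lie_action_const assms(1) by simp
  then show ?thesis using assms nabla_closed by (simp add: lie_action_metric)
qed

lemma jacobi:
  assumes "X \<in> VF" "Y \<in> VF" "Z \<in> VF"
  shows "bracket X (bracket Y Z) + bracket Y (bracket Z X) + bracket Z (bracket X Y) = 0"
proof (rule ext, rule ext)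
  fix p f
  have b: "bracket U (bracket V W) p f
      = U p (lie_action V (lie_action W f)) - U p (lie_action W (lie_action V f))
        - (V p (lie_action W (lie_action U f)) - W p (lie_action V (lie_action U f)))"
    if "f \<in> smooth_functions A" "U \<in> VF" "V \<in> VF" "W \<in> VF" for U V W
  proof -
    have "lie_action (bracket V W) f
        = (\<lambda>q. lie_action V (lie_action W f) q - lie_action W (lie_action V f) q)"
      by (simp add: fun_eq_iff lie_action_bracket)
    then have "lie_action U (lie_action (bracket V W) f) p
        = lie_action U (lie_action V (lie_action W f)) p
          - lie_action U (lie_action W (lie_action V f)) p"
      using lie_action_diff that by (simp add: lie_action_smooth)
    then show ?thesis by (simp add: bracket_def lie_action_def)
  qed
  show "(bracket X (bracket Y Z) + bracket Y (bracket Z X) + bracket Z (bracket X Y)) p f = 0 p f"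
  proof (cases "f \<in> smooth_functions A")
    case True
    show ?thesis using b[OF True] assms by simp
  next
    case False
    \<comment> \<open>Nested brackets are vector fields, and these vanish on non-smooth functions by
      the normalisation of \<open>tangent_space\<close>.\<close>
    have "bracket U (bracket V W) p f = 0" if "U \<in> VF" "V \<in> VF" "W \<in> VF" for U V W
      by (rule tangent_vector_not_smooth[OF vector_field_tangent False])
        (intro bracket_closed that)
    then show ?thesis using assms by simp
  qed
qed

section \<open>Symmetries of the curvature tensor\<close>

lemma curvature_closed: "X \<in> VF \<Longrightarrow> Y \<in> VF \<Longrightarrow> Z \<in> VF \<Longrightarrow> curvature nabla X Y Z \<in> VF"
  by (simp add: curvature_def field_closed)

abbreviation R4 where "R4 \<equiv> curvature4 g nabla"

lemma curvature4_expand: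
  assumes "X \<in> VF" "Y \<in> VF" "Z \<in> VF" "W \<in> VF"
  shows "R4 X Y Z W p = G (nabla X (nabla Y Z)) W p - G (nabla Y (nabla X Z)) W p
    - G (nabla (bracket X Y) Z) W p"
  using assms by (simp add: curvature4_def curvature_def metric_bilinear field_closed)

lemma curvature4_skew12:
  assumes "X \<in> VF" "Y \<in> VF" "Z \<in> VF" "W \<in> VF"
  shows "R4 Y X Z W p = - R4 X Y Z W p"
proof -
  have "nabla (bracket Y X) Z = nabla (nabla Y X) Z - nabla (nabla X Y) Z"
    and "nabla (bracket X Y) Z = nabla (nabla X Y) Z - nabla (nabla Y X) Z"
    using assms by (simp_all add: bracket_nabla nabla_diff nabla_closed)
  then show ?thesis
    using assms by (simp add: curvature4_expand metric_bilinear field_closed)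
qed

text \<open>Apply \<open>bracket X Y\<close> to the function \<open>G Z W\<close>, once directly and
  once as a commutator of second derivatives. The terms with one derivative on each factor are
  symmetric in the two directions and cancel.\<close>

lemma curvature4_skew34:
  assumes "X \<in> VF" "Y \<in> VF" "Z \<in> VF" "W \<in> VF"
  shows "R4 X Y W Z p = - R4 X Y Z W p"
proof -
  have dd: "lie_action U (lie_action V (G Z W)) p
      = G (nabla U (nabla V Z)) W p + G (nabla V Z) (nabla U W) p
        + G (nabla U Z) (nabla V W) p + G Z (nabla U (nabla V W)) p"
    if "U \<in> VF" "V \<in> VF" for U V
    using assms that
    by (simp add: lie_action_metric lie_action_add metric_smooth nabla_closed)
  have "lie_action (bracket X Y) (G Z W) p
      = G (nabla (bracket X Y) Z) W p + G Z (nabla (bracket X Y) W) p"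
    using assms by (simp add: lie_action_metric bracket_closed)
  then have "G (nabla (bracket X Y) Z) W p + G Z (nabla (bracket X Y) W) p
      = lie_action X (lie_action Y (G Z W)) p - lie_action Y (lie_action X (G Z W)) p"
    by (simp add: lie_action_bracket)
  then show ?thesis
    using assms dd[of X Y] dd[of Y X]
    by (simp add: curvature4_expand metric_sym[of _ Z] field_closed)
qed

text \<open>Torsion-freeness turns each double bracket of the Jacobi identity into covariant
  derivatives, which regroup into the cyclic sum of curvatures.\<close>

lemma curvature4_bianchi:
  assumes "X \<in> VF" "Y \<in> VF" "Z \<in> VF" "W \<in> VF"
  shows "R4 X Y Z W p + R4 Y Z X W p + R4 Z X Y W p = 0"
proof -
  have t: "bracket U (bracket V T)
      = nabla U (nabla V T) - nabla U (nabla T V) - nabla (bracket V T) U"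
    if "U \<in> VF" "V \<in> VF" "T \<in> VF" for U V T
  proof -
    have "bracket U (bracket V T) = nabla U (bracket V T) - nabla (bracket V T) U"
      using that by (simp add: bracket_nabla[of U] bracket_closed)
    then show ?thesis using that by (simp add: bracket_nabla[of V] nabla_diff nabla_closed)
  qed
  have "G (bracket X (bracket Y Z) + bracket Y (bracket Z X) + bracket Z (bracket X Y)) W p = 0"
    using jacobi[OF assms(1-3)] metric_scaleR_left[OF assms(4) assms(1), of 0 p] by simp
  then show ?thesis
    using assms by (simp add: t curvature4_expand metric_bilinear field_closed)
qed

text \<open>The octahedron argument: the four cyclic shifts of \<open>X, Y, Z, W\<close> give four
  Bianchi identities, and the two skew symmetries combine them into the claim.\<close>

lemma curvature4_pair:
  assumes "X \<in> VF" "Y \<in> VF" "Z \<in> VF" "W \<in> VF"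
  shows "R4 X Y Z W p = R4 Z W X Y p"
proof -
  note V = assms
  show ?thesis
    using curvature4_bianchi[OF V(1,2,3,4), of p] curvature4_bianchi[OF V(2,3,4,1), of p]
      curvature4_bianchi[OF V(3,4,1,2), of p] curvature4_bianchi[OF V(4,1,2,3), of p]
      curvature4_skew34[OF V(1,2,3,4), of p] curvature4_skew34[OF V(2,3,4,1), of p]
      curvature4_skew34[OF V(3,4,1,2), of p] curvature4_skew34[OF V(4,1,2,3), of p]
      curvature4_skew34[OF V(1,3,2,4), of p] curvature4_skew34[OF V(2,4,1,3), of p]
      curvature4_skew12[OF V(1,3,2,4), of p] curvature4_skew12[OF V(1,3,4,2), of p]
      curvature4_skew12[OF V(2,4,1,3), of p] curvature4_skew12[OF V(2,4,3,1), of p]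
    by linarith
qed

end

section \<open>Paracontact metric structures\<close>

locale paracontact_metric = levi_civita A g nabla
  for A :: "('a::t2_space, 'e::euclidean_space) atlas" and g nabla +
  fixes n :: nat
    and \<phi> :: "'a \<Rightarrow> 'a tangent_vector \<Rightarrow> 'a tangent_vector"
    and \<xi> :: "'a vector_field"
    and \<eta> :: "'a \<Rightarrow> 'a tangent_vector \<Rightarrow> real"
  assumes paracontact: "paracontact_metric_manifold A n \<phi> \<xi> \<eta> g"
begin

text \<open>
  The identities below are stated as equalities of the functions \<open>G V Z\<close> for all fields \<open>Z\<close> rather
  than as equalities of vector fields: nondegeneracy of the metric turns the former into the latter
  only once tangent vectors are known to extend to vector fields.
\<close>

abbreviation \<Phi> :: "'a vector_field \<Rightarrow> 'a vector_field" where "\<Phi> \<equiv> app \<phi>"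
abbreviation \<tau> where "\<tau> \<equiv> lie_derivative_metric \<xi> g"
abbreviation S :: "'a vector_field \<Rightarrow> 'a vector_field" where "S X \<equiv> nabla X \<xi>"
abbreviation h where "h \<equiv> h_tensor \<xi> \<phi>"
abbreviation B where "B \<equiv> covariant_derivative nabla \<xi> \<tau>"

lemma xi_closed: "\<xi> \<in> VF"
  using paracontact by (simp add: paracontact_metric_manifold_def almost_paracontact_def)

lemma phi_closed: "X \<in> VF \<Longrightarrow> \<Phi> X \<in> VF"
  using paracontact
  by (simp add: paracontact_metric_manifold_def almost_paracontact_def endomorphism_field_def)

lemmas closed = field_closed xi_closed phi_closed

lemma phi_xi: "\<phi> p (\<xi> p) = 0" and eta_xi: "\<eta> p (\<xi> p) = 1"
  using paracontact by (simp_all add: paracontact_metric_manifold_def almost_paracontact_def)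

lemma eta_phi: "u \<in> tangent_space A p \<Longrightarrow> \<eta> p (\<phi> p u) = 0"
  and phi_phi: "u \<in> tangent_space A p \<Longrightarrow> \<phi> p (\<phi> p u) = u - \<eta> p u *\<^sub>R \<xi> p"
  using paracontact by (simp_all add: paracontact_metric_manifold_def almost_paracontact_def)

lemma metric_zero: "X \<in> VF \<Longrightarrow> g p (X p) 0 = 0"
  using metric_scaleR_right[of X X 0 p] by (simp add: app2_def)

lemma metric_phi_phi: "X \<in> VF \<Longrightarrow> Y \<in> VF \<Longrightarrow> G (\<Phi> X) (\<Phi> Y) p = - G X Y p + app \<eta> X p * app \<eta> Y p"
  using paracontact vector_field_tangent
  by (simp add: paracontact_metric_manifold_def compatible_metric_def app2_def app_def)

lemma eta_metric:
  assumes "X \<in> VF"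
  shows "app \<eta> X = G \<xi> X"
proof
  fix p
  have "G (\<Phi> X) (\<Phi> \<xi>) p = 0"
    using metric_zero[OF phi_closed[OF assms]] by (simp add: app2_def app_def[of _ \<xi>] phi_xi)
  then show "app \<eta> X p = G \<xi> X p"
    using metric_phi_phi[OF assms xi_closed, of p] metric_sym[OF assms xi_closed]
    by (simp add: app_def[of _ \<xi>] eta_xi)
qed

lemma metric_xi_xi: "G \<xi> \<xi> p = 1"
  using eta_metric[OF xi_closed] eta_xi by (metis app_def)

lemma metric_xi_phi: "X \<in> VF \<Longrightarrow> G \<xi> (\<Phi> X) p = 0"
  using eta_metric[OF phi_closed, of X] eta_phi[OF vector_field_tangent, of X p]
  by (metis app_def)

lemma phi_phi_field: "X \<in> VF \<Longrightarrow> \<Phi> (\<Phi> X) = X - fmult (G \<xi> X) \<xi>"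
  using phi_phi[OF vector_field_tangent, of X] eta_metric[of X]
  by (auto simp: app_def fmult_def fun_eq_iff)

lemma fmult_xi_closed: "X \<in> VF \<Longrightarrow> fmult (G \<xi> X) \<xi> \<in> VF"
  by (simp add: vector_fields_fmult metric_smooth xi_closed)

lemma metric_phi_phi_right:
  "X \<in> VF \<Longrightarrow> Y \<in> VF \<Longrightarrow> G X (\<Phi> (\<Phi> Y)) p = G X Y p - G \<xi> X p * G \<xi> Y p"
  by (simp add: phi_phi_field metric_diff_right fmult_xi_closed closed metric_fmult_right
      metric_sym[of X \<xi>])

lemma metric_phi_skew:
  assumes "X \<in> VF" "Y \<in> VF"
  shows "G (\<Phi> X) Y p = - G X (\<Phi> Y) p"
proof -
  have "G (\<Phi> X) (\<Phi> (\<Phi> Y)) p = - G X (\<Phi> Y) p"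
    using assms by (simp add: metric_phi_phi closed eta_metric metric_xi_phi)
  then show ?thesis
    using assms by (simp add: metric_phi_phi_right closed metric_xi_phi)
qed

section \<open>The covariant derivative of \<open>\<xi>\<close> and invariance along
  \<open>\<xi>\<close>\<close>

lemma metric_S_xi:
  assumes "X \<in> VF"
  shows "G (S X) \<xi> p = 0" and "G \<xi> (S X) p = 0"
proof -
  have "G \<xi> \<xi> = (\<lambda>_. 1)" by (simp add: fun_eq_iff metric_xi_xi)
  then have "lie_action X (G \<xi> \<xi>) p = 0" using lie_action_const[OF assms] by simp
  then show "G (S X) \<xi> p = 0" and "G \<xi> (S X) p = 0"
    using assms by (simp_all add: lie_action_metric closed metric_sym[of "S X" \<xi>])
qed

text \<open>For the 1-form dual to \<open>\<xi>\<close>, the exterior derivative is the skew part of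
  \<open>S\<close>; the factor 2 undoes the 1/2 in the convention for
  \<open>exterior_derivative\<close>.\<close>

lemma metric_S_skew_part:
  assumes "X \<in> VF" "Y \<in> VF"
  shows "2 * G X (\<Phi> Y) p = G (S X) Y p - G X (S Y) p"
proof -
  have "G X (\<Phi> Y) p = exterior_derivative \<eta> X Y p"
    using paracontact assms by (simp add: paracontact_metric_manifold_def)
  then show ?thesis
    using assms
    by (simp add: exterior_derivative_def eta_metric closed bracket_nabla lie_action_metric
        metric_bilinear metric_sym[of "S Y" X])
qed

text \<open>The integral curves of \<open>\<xi>\<close> are geodesics: \<open>\<xi>\<close> is a
  unit field and lies in the kernel of the exterior derivative of \<open>\<eta>\<close>.\<close>

lemma metric_S_xi_xi:
  assumes "X \<in> VF"
  shows "G (S \<xi>) X p = 0" and "G X (S \<xi>) p = 0"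
proof -
  show "G (S \<xi>) X p = 0"
    using metric_S_skew_part[OF xi_closed assms, of p] metric_xi_phi[OF assms] metric_S_xi[OF assms]
    by simp
  then show "G X (S \<xi>) p = 0" using assms by (simp add: metric_sym[of X "S \<xi>"] closed)
qed

text \<open>Two forms of the invariance of \<open>\<eta>\<close> along \<open>\<xi>\<close>: it is
  parallel in that direction, and its Lie derivative vanishes.\<close>

lemma lie_action_xi_eta:
  assumes "X \<in> VF"
  shows "lie_action \<xi> (G \<xi> X) p = G \<xi> (nabla \<xi> X) p"
    and "lie_action \<xi> (G \<xi> X) p = G \<xi> (bracket \<xi> X) p"
  using assms
  by (simp_all add: lie_action_metric closed metric_S_xi_xi bracket_nabla metric_bilinear metric_S_xi)

text \<open>\<open>\<L>\<^sub>\<xi>d\<eta> = 0\<close>: Cartan's formula, as \<open>d\<eta>\<close> is closed and \<open>d\<eta>(\<xi>, \<cdot>) = 0\<close>.\<close>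

lemma lie_derivative_fundamental_form:
  assumes "X \<in> VF" "Y \<in> VF"
  shows "lie_action \<xi> (G X (\<Phi> Y)) p = G (bracket \<xi> X) (\<Phi> Y) p + G X (\<Phi> (bracket \<xi> Y)) p"
proof -
  let ?d = "\<lambda>U V p. lie_action U (G \<xi> V) p - lie_action V (G \<xi> U) p - G \<xi> (bracket U V) p"
  have d: "G U (\<Phi> V) q = 1/2 * ?d U V q" if "U \<in> VF" "V \<in> VF" for U V q
    using paracontact that
    by (simp add: paracontact_metric_manifold_def exterior_derivative_def eta_metric closed)
  have sm: "G \<xi> U \<in> smooth_functions A" if "U \<in> VF" for U
    using that by (simp add: metric_smooth xi_closed)
  have sm': "(\<lambda>q. lie_action U f q - lie_action V f' q) \<in> smooth_functions A"
    if "U \<in> VF" "V \<in> VF" "f \<in> smooth_functions A" "f' \<in> smooth_functions A" for U V f f'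
    using smooth_functions_add'[OF lie_action_smooth[OF that(1,3)]
        smooth_functions_scale[OF lie_action_smooth[OF that(2,4)], of "-1"]] by simp
  have sd: "?d X Y \<in> smooth_functions A"
    using smooth_functions_add'[OF sm'[OF assms sm[OF assms(2)] sm[OF assms(1)]]
        smooth_functions_scale[OF sm[OF bracket_closed[OF assms]], of "-1"]]
    by simp
  have "G X (\<Phi> Y) = (\<lambda>q. 1/2 * ?d X Y q)" by (rule ext) (rule d[OF assms])
  then have "lie_action \<xi> (G X (\<Phi> Y)) p = 1/2 * lie_action \<xi> (?d X Y) p"
    by (simp only: lie_action_scale[OF xi_closed sd])
  also have "lie_action \<xi> (?d X Y) p = lie_action \<xi> (lie_action X (G \<xi> Y)) p
      - lie_action \<xi> (lie_action Y (G \<xi> X)) p - lie_action \<xi> (G \<xi> (bracket X Y)) p"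
    using lie_action_diff[OF xi_closed sm'[OF assms sm[OF assms(2)] sm[OF assms(1)]]
        sm[OF bracket_closed[OF assms]]]
      lie_action_diff[OF xi_closed lie_action_smooth[OF assms(1) sm[OF assms(2)]]
        lie_action_smooth[OF assms(2) sm[OF assms(1)]]]
    by simp
  finally have 1: "2 * lie_action \<xi> (G X (\<Phi> Y)) p = lie_action \<xi> (lie_action X (G \<xi> Y)) p
      - lie_action \<xi> (lie_action Y (G \<xi> X)) p - G \<xi> (bracket \<xi> (bracket X Y)) p"
    using lie_action_xi_eta(2)[of "bracket X Y" p] assms by (simp add: closed)
  have lx: "lie_action U (G \<xi> (bracket \<xi> V)) p = lie_action U (lie_action \<xi> (G \<xi> V)) p"
    if "V \<in> VF" for U V
  proof -
    have "G \<xi> (bracket \<xi> V) = lie_action \<xi> (G \<xi> V)"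
      using lie_action_xi_eta(2)[OF that] by (simp add: fun_eq_iff)
    then show ?thesis by simp
  qed
  have 2: "2 * G (bracket \<xi> X) (\<Phi> Y) p = lie_action \<xi> (lie_action X (G \<xi> Y)) p
      - lie_action X (lie_action \<xi> (G \<xi> Y)) p - lie_action Y (lie_action \<xi> (G \<xi> X)) p
      - G \<xi> (bracket (bracket \<xi> X) Y) p"
    using d[of "bracket \<xi> X" Y p] lx[of X Y] assms by (simp add: closed lie_action_bracket)
  have 3: "2 * G X (\<Phi> (bracket \<xi> Y)) p = lie_action X (lie_action \<xi> (G \<xi> Y)) p
      - lie_action \<xi> (lie_action Y (G \<xi> X)) p + lie_action Y (lie_action \<xi> (G \<xi> X)) p
      - G \<xi> (bracket X (bracket \<xi> Y)) p"
    using d[of X "bracket \<xi> Y" p] lx[of Y X] assms by (simp add: closed lie_action_bracket)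
  have sw: "G \<xi> (bracket U V) p = - G \<xi> (bracket V U) p" if "U \<in> VF" "V \<in> VF" for U V
    using that by (simp add: bracket_nabla closed metric_bilinear)
  \<comment> \<open>The second derivatives in \<open>1\<close> match those in the sum of
    \<open>2\<close> and \<open>3\<close>; what remains to be compared is \<open>\<eta>\<close> of
    the Jacobi identity.\<close>
  have "G \<xi> (bracket \<xi> (bracket X Y) + bracket X (bracket Y \<xi>) + bracket Y (bracket \<xi> X)) p = 0"
    using jacobi[OF xi_closed assms] metric_zero[OF xi_closed] by (simp add: app2_def)
  then have "G \<xi> (bracket \<xi> (bracket X Y)) p + G \<xi> (bracket X (bracket Y \<xi>)) p
      + G \<xi> (bracket Y (bracket \<xi> X)) p = 0"
    using assms by (simp add: metric_bilinear closed)
  moreover have "G \<xi> (bracket X (bracket Y \<xi>)) p = - G \<xi> (bracket X (bracket \<xi> Y)) p"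
    using assms by (simp add: bracket_nabla nabla_diff closed metric_bilinear)
  ultimately show ?thesis
    using 1 2 3 sw[of "bracket \<xi> X" Y] assms by (simp add: closed)
qed

section \<open>Invariance of \<open>\<tau>\<close> under \<open>\<phi>\<close>, and parallelism of
  \<open>\<phi>\<close> along \<open>\<xi>\<close>\<close>

lemma tau_eq:
  assumes "X \<in> VF" "Y \<in> VF"
  shows "\<tau> X Y p = G (S X) Y p + G X (S Y) p"
  using assms
  by (simp add: lie_derivative_metric_def lie_action_metric bracket_nabla closed metric_bilinear)

lemma tau_sym: "X \<in> VF \<Longrightarrow> Y \<in> VF \<Longrightarrow> \<tau> X Y p = \<tau> Y X p"
  by (simp add: tau_eq metric_sym[of X "S Y"] metric_sym[of "S X" Y] closed)

text \<open>Eliminating \<open>S X\<close> leaves \<open>X\<close> only as an argument of the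
  metric, so an equality known only through pairings can be substituted in the first slot of
  \<open>\<tau>\<close>.\<close>

lemma tau_tensor:
  "X \<in> VF \<Longrightarrow> Y \<in> VF \<Longrightarrow> \<tau> X Y p = 2 * G X (\<Phi> Y) p + 2 * G X (S Y) p"
  by (simp add: tau_eq metric_S_skew_part)

lemma tau_xi: "X \<in> VF \<Longrightarrow> \<tau> \<xi> X p = 0"
  by (simp add: tau_eq closed metric_S_xi metric_S_xi_xi)

lemma tau_phi_phi_left:
  assumes "X \<in> VF" "Y \<in> VF"
  shows "\<tau> (\<Phi> (\<Phi> X)) Y p = \<tau> X Y p"
proof -
  have "G (\<Phi> (\<Phi> X)) Z p = G Z X p - G \<xi> Z p * G \<xi> X p" if "Z \<in> VF" for Z
    using that assms(1) by (simp add: metric_phi_phi_right closed metric_sym[of _ Z])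
  then show ?thesis
    using assms by (simp add: tau_tensor closed metric_xi_phi metric_S_xi metric_sym[of X])
qed

text \<open>The left-hand side is \<open>G X ((\<nabla>\<^sub>\<xi>\<phi>) Y)\<close>.\<close>

lemma nabla_xi_phi_aux:
  assumes "X \<in> VF" "Y \<in> VF"
  shows "G X (nabla \<xi> (\<Phi> Y)) p - G X (\<Phi> (nabla \<xi> Y)) p = G (\<Phi> X) (S Y) p - G (S X) (\<Phi> Y) p"
proof -
  have "G (bracket \<xi> X) (\<Phi> Y) p = G (nabla \<xi> X) (\<Phi> Y) p - G (S X) (\<Phi> Y) p"
    using assms by (simp add: bracket_nabla closed metric_bilinear)
  moreover have "G X (\<Phi> (bracket \<xi> Y)) p = G X (\<Phi> (nabla \<xi> Y)) p + G (\<Phi> X) (S Y) p"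
    using metric_phi_skew[of X "bracket \<xi> Y" p] metric_phi_skew[of X "nabla \<xi> Y" p] assms
    by (simp add: bracket_nabla closed metric_bilinear)
  ultimately show ?thesis
    using lie_derivative_fundamental_form[OF assms, of p] assms
    by (simp add: lie_action_metric closed)
qed

lemma tau_phi_phi:
  assumes "X \<in> VF" "Y \<in> VF"
  shows "\<tau> (\<Phi> X) (\<Phi> Y) p = \<tau> X Y p"
proof -
  \<comment> \<open>Both \<open>\<eta>\<close> and \<open>\<xi>\<close> are parallel along
    \<open>\<xi>\<close>, hence so is the square of \<open>\<phi>\<close>; this and the next step
    express it through pairings.\<close>
  have "G X (nabla \<xi> (\<Phi> (\<Phi> Y))) p
      = G X (nabla \<xi> Y) p - lie_action \<xi> (G \<xi> Y) p * G X \<xi> p"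
  proof -
    have "nabla \<xi> (\<Phi> (\<Phi> Y)) = nabla \<xi> Y
        - (fmult (lie_action \<xi> (G \<xi> Y)) \<xi> + fmult (G \<xi> Y) (S \<xi>))"
      using assms
      by (simp add: phi_phi_field nabla_diff closed fmult_xi_closed nabla_fmult metric_smooth)
    then show ?thesis
      using assms metric_smooth lie_action_smooth
      by (simp add: metric_bilinear closed vector_fields_fmult metric_fmult_right metric_S_xi_xi)
  qed
  also have "\<dots> = G X (\<Phi> (\<Phi> (nabla \<xi> Y))) p"
    using assms by (simp add: metric_phi_phi_right closed lie_action_xi_eta(1) metric_sym[of X \<xi>])
  finally have "G X (nabla \<xi> (\<Phi> (\<Phi> Y))) p = G X (\<Phi> (\<Phi> (nabla \<xi> Y))) p" .
  \<comment> \<open>By the parallelism of the square and the skewness of \<open>\<phi>\<close>, this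
    instance of \<open>nabla_xi_phi_aux\<close> and the next have equal left-hand sides; equating
    the right-hand sides is the claim.\<close>
  moreover have "G X (nabla \<xi> (\<Phi> (\<Phi> Y))) p - G X (\<Phi> (nabla \<xi> (\<Phi> Y))) p
      = G (\<Phi> X) (S (\<Phi> Y)) p - G (S X) Y p"
    using nabla_xi_phi_aux[of X "\<Phi> Y" p] assms
    by (simp add: closed metric_phi_phi_right metric_S_xi)
  moreover have "G (\<Phi> X) (nabla \<xi> (\<Phi> Y)) p - G (\<Phi> X) (\<Phi> (nabla \<xi> Y)) p
      = G X (S Y) p - G (S (\<Phi> X)) (\<Phi> Y) p"
    using nabla_xi_phi_aux[of "\<Phi> X" Y p] assms
    by (simp add: closed metric_phi_phi_right metric_S_xi metric_sym[of "\<Phi> (\<Phi> X)"]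
        metric_sym[of X "S Y"])
  ultimately show ?thesis
    using assms metric_phi_skew[of X "nabla \<xi> (\<Phi> Y)" p] metric_phi_skew[of X "\<Phi> (nabla \<xi> Y)" p]
    by (simp add: tau_eq closed)
qed

lemma tau_phi_swap: "X \<in> VF \<Longrightarrow> Y \<in> VF \<Longrightarrow> \<tau> (\<Phi> X) Y p = \<tau> X (\<Phi> Y) p"
  using tau_phi_phi[of "\<Phi> X" Y p] tau_phi_phi_left[of X "\<Phi> Y" p] by (simp add: closed)

text \<open>\<open>\<tau> (\<Phi> X) Y\<close> and \<open>G (\<Phi> X) (\<Phi> Y)\<close> are both
  symmetric in \<open>X\<close> and \<open>Y\<close>. The result says that the right-hand side of
  \<open>nabla_xi_phi_aux\<close> vanishes, so that \<open>\<phi>\<close> is parallel along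
  \<open>\<xi>\<close>.\<close>

lemma metric_phi_S:
  assumes "X \<in> VF" "Y \<in> VF"
  shows "G (\<Phi> X) (S Y) p = G (S X) (\<Phi> Y) p"
proof -
  have "2 * G (\<Phi> X) (S Y) p = \<tau> (\<Phi> X) Y p - 2 * G (\<Phi> X) (\<Phi> Y) p"
    using assms by (simp add: tau_tensor closed)
  moreover have "2 * G (\<Phi> Y) (S X) p = \<tau> (\<Phi> Y) X p - 2 * G (\<Phi> Y) (\<Phi> X) p"
    using assms by (simp add: tau_tensor closed)
  ultimately show ?thesis
    using assms
    by (simp add: metric_sym[of "\<Phi> Y"] tau_phi_swap[of Y X] tau_sym[of Y "\<Phi> X"] closed)
qed

lemma nabla_xi_phi:
  "X \<in> VF \<Longrightarrow> Y \<in> VF \<Longrightarrow> G X (nabla \<xi> (\<Phi> Y)) p = G X (\<Phi> (nabla \<xi> Y)) p"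
  using nabla_xi_phi_aux[of X Y p] metric_phi_S[of X Y p] by simp

section \<open>The tensor \<open>h\<close>\<close>

lemma h_closed: "X \<in> VF \<Longrightarrow> h X \<in> VF"
  by (simp add: h_tensor_def lie_derivative_endomorphism_def closed)

text \<open>Once \<open>\<phi>\<close> is parallel along \<open>\<xi>\<close>, its Lie derivative
  reduces to a commutator, 2h = \<phi>S - S\<phi>, and moving \<open>\<phi>\<close> across the
  metric turns this into \<open>\<tau>\<close>.\<close>

lemma metric_h:
  assumes "X \<in> VF" "Y \<in> VF"
  shows "2 * G X (h Y) p = - \<tau> X (\<Phi> Y) p"
proof -
  have "2 * G X (h Y) p = G X (nabla \<xi> (\<Phi> Y)) p - G X (S (\<Phi> Y)) p + G (\<Phi> X) (bracket \<xi> Y) p"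
    using assms
    by (simp add: h_tensor_def lie_derivative_endomorphism_def bracket_nabla[of \<xi> "\<Phi> Y"] closed
        metric_bilinear metric_phi_skew)
  also have "G (\<Phi> X) (bracket \<xi> Y) p = - G X (\<Phi> (nabla \<xi> Y)) p - G (\<Phi> X) (S Y) p"
    using assms by (simp add: bracket_nabla closed metric_bilinear metric_phi_skew[of X "nabla \<xi> Y"])
  finally show ?thesis
    using assms by (simp add: nabla_xi_phi metric_phi_S tau_eq closed)
qed

lemma metric_xi_h: "X \<in> VF \<Longrightarrow> G \<xi> (h X) p = 0"
  using metric_h[OF xi_closed, of X p] by (simp add: tau_xi closed)

text \<open>\<open>\<phi>h = S + \<phi>\<close>, i.e. \<open>\<nabla>\<xi> = -\<phi> + \<phi>h\<close>.\<close>

lemma metric_phi_h: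
  assumes "X \<in> VF" "Z \<in> VF"
  shows "2 * G Z (\<Phi> (h X)) p = \<tau> Z X p"
    and "G Z (\<Phi> (h X)) p = G Z (\<Phi> X) p + G Z (S X) p"
proof -
  have "2 * G Z (\<Phi> (h X)) p = - (2 * G (\<Phi> Z) (h X) p)"
    using assms by (simp add: metric_phi_skew h_closed)
  also have "\<dots> = \<tau> Z X p"
    using assms by (simp add: metric_h closed tau_phi_phi)
  finally show "2 * G Z (\<Phi> (h X)) p = \<tau> Z X p" .
  then show "G Z (\<Phi> (h X)) p = G Z (\<Phi> X) p + G Z (S X) p"
    using assms by (simp add: tau_tensor)
qed

lemma metric_phi_h_phi_h:
  "X \<in> VF \<Longrightarrow> Y \<in> VF \<Longrightarrow> G (\<Phi> (h X)) (\<Phi> (h Y)) p = - G (h X) (h Y) p"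
  by (simp add: metric_phi_phi h_closed eta_metric metric_xi_h)

text \<open>The left-hand side is g(S^2 X, Y), as it will occur in the curvature. The value comes
  from expanding \<open>G (\<Phi> (h X)) (\<Phi> (h Y))\<close> with \<phi>h = S + \<phi>.\<close>

lemma metric_h_h:
  assumes "X \<in> VF" "Y \<in> VF"
  shows "G (S X) (S Y) p + 2 * G (S X) (\<Phi> Y) p
    = G X Y p - G \<xi> X p * G \<xi> Y p - G (h X) (h Y) p"
proof -
  have "- G (h X) (h Y) p = G (\<Phi> (h X)) (\<Phi> Y) p + G (\<Phi> (h X)) (S Y) p"
    using metric_phi_h(2)[of Y "\<Phi> (h X)" p] metric_phi_h_phi_h[of X Y p] assms
    by (simp add: closed h_closed)
  also have "G (\<Phi> (h X)) (\<Phi> Y) p = G (\<Phi> Y) (\<Phi> X) p + G (\<Phi> Y) (S X) p"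
    using metric_phi_h(2)[of X "\<Phi> Y" p] assms
    by (simp add: closed h_closed metric_sym[of "\<Phi> (h X)" "\<Phi> Y"])
  also have "G (\<Phi> (h X)) (S Y) p = G (S Y) (\<Phi> X) p + G (S Y) (S X) p"
    using metric_phi_h(2)[of X "S Y" p] assms
    by (simp add: closed h_closed metric_sym[of "\<Phi> (h X)" "S Y"])
  finally show ?thesis
    using assms metric_phi_S[of X Y p] metric_phi_phi[of X Y p]
    by (simp add: closed eta_metric metric_sym[of "S Y"] metric_sym[of "\<Phi> Y"])
qed

text \<open>\<open>h\<close> anticommutes with \<open>\<phi>\<close> and takes values in the contact
  distribution, where \<open>\<phi>\<close> is an anti-isometry.\<close>

lemma metric_h_phi:
  assumes "X \<in> VF" "Y \<in> VF"
  shows "G (h (\<Phi> X)) (h (\<Phi> Y)) p = - G (h X) (h Y) p"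
proof -
  have w: "G Z (h (\<Phi> V)) p = - G Z (\<Phi> (h V)) p" if "Z \<in> VF" "V \<in> VF" for Z V
    using metric_h[of Z "\<Phi> V" p] metric_phi_h(1)[of V Z p] that
      tau_phi_phi_left[of V Z p] tau_sym[of Z "\<Phi> (\<Phi> V)" p] tau_sym[of Z V p]
    by (simp add: closed)
  have "G (h (\<Phi> X)) (h (\<Phi> Y)) p = - G (\<Phi> (h Y)) (h (\<Phi> X)) p"
    using w[of "h (\<Phi> X)" Y] assms by (simp add: closed h_closed metric_sym[of "h (\<Phi> X)" "\<Phi> (h Y)"])
  also have "\<dots> = G (\<Phi> (h X)) (\<Phi> (h Y)) p"
    using w[of "\<Phi> (h Y)" X] assms by (simp add: closed h_closed metric_sym[of "\<Phi> (h Y)" "\<Phi> (h X)"])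
  finally show ?thesis using assms by (simp add: metric_phi_h_phi_h)
qed

section \<open>The covariant derivative of \<open>\<tau>\<close> along \<open>\<xi>\<close>\<close>

definition P :: "'a vector_field \<Rightarrow> 'a vector_field"
  where "P X = nabla \<xi> (S X) - S (nabla \<xi> X)"

lemma P_closed: "X \<in> VF \<Longrightarrow> P X \<in> VF"
  by (simp add: P_def closed)

text \<open>\<open>P\<close> is the covariant derivative of the endomorphism \<open>S\<close> along
  \<open>\<xi>\<close>. The skew part of \<open>S\<close> is given by \<open>\<phi>\<close>, which
  is parallel along \<open>\<xi>\<close>, so only the symmetric part contributes.\<close>

lemma P_sym:
  assumes "X \<in> VF" "Y \<in> VF"
  shows "G (P X) Y p = G X (P Y) p"
proof -
  have f: "(\<lambda>p. 2 * G X (\<Phi> Y) p) = (\<lambda>p. G (S X) Y p - G X (S Y) p)"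
    using assms by (simp add: metric_S_skew_part)
  have "2 * lie_action \<xi> (G X (\<Phi> Y)) p = lie_action \<xi> (G (S X) Y) p - lie_action \<xi> (G X (S Y)) p"
    using lie_action_scale[OF xi_closed metric_smooth[OF assms(1) phi_closed[OF assms(2)]], of 2 p]
      assms
    unfolding f by (simp add: lie_action_diff closed metric_smooth)
  moreover have "2 * lie_action \<xi> (G X (\<Phi> Y)) p
      = 2 * G (nabla \<xi> X) (\<Phi> Y) p + 2 * G X (\<Phi> (nabla \<xi> Y)) p"
    using assms by (simp add: lie_action_metric closed nabla_xi_phi)
  ultimately show ?thesis
    using assms
    by (simp add: lie_action_metric closed metric_S_skew_part P_def metric_bilinear)
qed

lemma B_metric:
  assumes "X \<in> VF" "Y \<in> VF"
  shows "B X Y p = 2 * G (P X) Y p"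
proof -
  have t: "\<tau> X Y = (\<lambda>q. G (S X) Y q + G X (S Y) q)" using assms tau_eq by blast
  have "lie_action \<xi> (\<tau> X Y) p = lie_action \<xi> (G (S X) Y) p + lie_action \<xi> (G X (S Y)) p"
    unfolding t using assms by (simp add: lie_action_add closed metric_smooth)
  then have "B X Y p = G (P X) Y p + G X (P Y) p"
    using assms
    by (simp add: covariant_derivative_def tau_eq lie_action_metric closed P_def metric_bilinear)
  then show ?thesis using P_sym[OF assms] by simp
qed

lemma B_sym: "X \<in> VF \<Longrightarrow> Y \<in> VF \<Longrightarrow> B X Y p = B Y X p"
  by (simp add: B_metric P_sym[of X Y] metric_sym[of X "P Y"] P_closed)

lemma B_xi:
  assumes "X \<in> VF"
  shows "B \<xi> X p = 0"
proof -
  have "\<tau> \<xi> X = (\<lambda>_. 0)" using tau_xi[OF assms] by blast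
  moreover have "\<tau> (S \<xi>) X p = 0"
    using assms by (simp add: tau_tensor closed metric_S_xi_xi)
  ultimately show ?thesis
    using assms by (simp add: covariant_derivative_def closed tau_xi lie_action_const)
qed

lemma B_phi_phi:
  assumes "X \<in> VF" "Y \<in> VF"
  shows "B (\<Phi> X) (\<Phi> Y) p = B X Y p"
proof -
  have t: "\<tau> (nabla \<xi> (\<Phi> U)) Z p = \<tau> (\<Phi> (nabla \<xi> U)) Z p" if "U \<in> VF" "Z \<in> VF" for U Z
  proof -
    have "G (nabla \<xi> (\<Phi> U)) W p = G (\<Phi> (nabla \<xi> U)) W p" if "W \<in> VF" for W
      using nabla_xi_phi[OF that \<open>U \<in> VF\<close>, of p] that \<open>U \<in> VF\<close>
      by (simp add: metric_sym[of W "nabla \<xi> (\<Phi> U)"] metric_sym[of W "\<Phi> (nabla \<xi> U)"] closed)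
    then show ?thesis using that by (simp add: tau_tensor closed)
  qed
  have "\<tau> (\<Phi> X) (\<Phi> Y) = \<tau> X Y" using tau_phi_phi[OF assms] by blast
  moreover have "\<tau> (nabla \<xi> (\<Phi> X)) (\<Phi> Y) p = \<tau> (nabla \<xi> X) Y p"
    using assms by (simp add: t closed tau_phi_phi)
  moreover have "\<tau> (\<Phi> X) (nabla \<xi> (\<Phi> Y)) p = \<tau> X (nabla \<xi> Y) p"
    using t[of Y "\<Phi> X"] assms
    by (simp add: closed tau_sym[of "\<Phi> X"] tau_phi_phi tau_sym[of X])
  ultimately show ?thesis by (simp add: covariant_derivative_def)
qed

lemma B_linear:
  assumes "X \<in> VF" "Y \<in> VF" "Z \<in> VF"
  shows "B X (Y + Z) p = B X Y p + B X Z p" and "B (Y + Z) X p = B Y X p + B Z X p"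
    and "B X (r *\<^sub>R Y) p = r * B X Y p" and "B (r *\<^sub>R Y) X p = r * B Y X p"
  using assms
  by (simp_all add: B_sym[of _ X] B_metric[of X] metric_bilinear P_closed closed)

lemma B_sub_xi:
  assumes "X \<in> VF" "Y \<in> VF"
  shows "B (X - fmult (G \<xi> X) \<xi>) Y p = B X Y p"
proof -
  have "B Y \<xi> p = 0" using B_xi[OF assms(2), of p] B_sym[OF assms(2) xi_closed] by simp
  then have "B Y (X - fmult (G \<xi> X) \<xi>) p = B Y X p"
    using assms
    by (simp add: closed fmult_xi_closed B_metric metric_diff_right P_closed metric_fmult_right)
  then show ?thesis
    using assms B_sym[of Y "X - fmult (G \<xi> X) \<xi>" p] B_sym[of Y X p]
    by (simp add: closed fmult_xi_closed)
qed

section \<open>Curvature of planes containing \<open>\<xi>\<close>\<close>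

lemma xi_curvature:
  assumes "X \<in> VF" "Y \<in> VF"
  shows "R4 X \<xi> \<xi> Y p = - (1/2) * B X Y p - G X Y p + G \<xi> X p * G \<xi> Y p + G (h X) (h Y) p"
proof -
  have "nabla (bracket X \<xi>) \<xi> = S (S X) - S (nabla \<xi> X)"
    using assms by (simp add: bracket_nabla closed nabla_diff)
  moreover have "G (nabla X (S \<xi>)) Y p = 0"
    by (rule nabla_weak_zero[OF assms(1) nabla_closed[OF xi_closed xi_closed] assms(2)])
      (rule metric_S_xi_xi)
  ultimately have "R4 X \<xi> \<xi> Y p = - G (P X) Y p - G (S (S X)) Y p"
    using assms by (simp add: curvature4_expand closed metric_bilinear P_def)
  moreover have "G (S (S X)) Y p = G (S X) (S Y) p + 2 * G (S X) (\<Phi> Y) p"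
    using assms by (simp add: metric_S_skew_part closed)
  ultimately show ?thesis
    using assms metric_h_h[OF assms, of p] B_metric[OF assms, of p] by simp
qed

lemma xi_sectional_curvature:
  assumes "X \<in> VF" "\<epsilon> \<in> {1, -1}" "app \<eta> X p = 0" "G X X p = \<epsilon>"
  shows "xi_sectional_curvature g nabla \<xi> X p = - (1/2) * \<epsilon> * B X X p - 1 + \<epsilon> * G (h X) (h X) p"
  using assms eta_metric[OF assms(1)]
  by (auto simp: xi_sectional_curvature_def xi_curvature algebra_simps)

text \<open>
  On unit vectors the condition on the sectional curvatures makes \<open>g(X, X) B(X, X)\<close> constant,
  and passing from \<open>X\<close> to \<open>\<phi>X\<close> changes its sign. A null vector \<open>X\<close> is reached along \<open>X + tY\<close> with
  \<open>Y\<close> non-null, unless the metric vanishes on the whole contact distribution.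
\<close>

lemma B_zero:
  assumes K: "\<And>X Y \<epsilon> \<epsilon>'. X \<in> VF \<Longrightarrow> Y \<in> VF \<Longrightarrow> \<epsilon> \<in> {1, -1} \<Longrightarrow> \<epsilon>' \<in> {1, -1} \<Longrightarrow>
      app \<eta> X p = 0 \<Longrightarrow> G X X p = \<epsilon> \<Longrightarrow> app \<eta> Y p = 0 \<Longrightarrow> G Y Y p = \<epsilon>' \<Longrightarrow>
      xi_sectional_curvature g nabla \<xi> X p - xi_sectional_curvature g nabla \<xi> Y p
        = \<epsilon> * G (h X) (h X) p - \<epsilon>' * G (h Y) (h Y) p"
    and XY: "X \<in> VF" "Y \<in> VF"
  shows "B X Y p = 0"
proof -
  define D where "D = {X \<in> VF. G \<xi> X p = 0}"
  have DV: "X \<in> VF" if "X \<in> D" for X using that by (simp add: D_def)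
  have Dadd: "X + Y \<in> D" if "X \<in> D" "Y \<in> D" for X Y
    using that by (simp add: D_def closed metric_bilinear)
  have Dscale: "r *\<^sub>R X \<in> D" if "X \<in> D" for X r
    using that by (simp add: D_def closed metric_bilinear)
  have unit: "B X X p = 0" if X: "X \<in> D" and e: "G X X p \<in> {1, -1}" for X
  proof -
    have X': "X \<in> VF" "app \<eta> X p = 0" and p: "app \<eta> (\<Phi> X) p = 0"
      and g: "G (\<Phi> X) (\<Phi> X) p = - G X X p"
      using X by (simp_all add: D_def eta_metric closed metric_xi_phi metric_phi_phi)
    have e': "- G X X p \<in> {1, -1}" using e by auto
    have "- (1/2) * G X X p * B X X p = - (1/2) * (- G X X p) * B (\<Phi> X) (\<Phi> X) p"
      using K[OF X'(1) phi_closed[OF X'(1)] e e' X'(2) refl p g]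
        xi_sectional_curvature[OF X'(1) e X'(2) refl]
        xi_sectional_curvature[OF phi_closed[OF X'(1)] e' p g] by linarith
    then show ?thesis using e B_phi_phi[OF X'(1) X'(1)] by auto
  qed
  have nonnull: "B X X p = 0" if X: "X \<in> D" and e: "G X X p \<noteq> 0" for X
  proof -
    let ?r = "1 / sqrt \<bar>G X X p\<bar>"
    have "G (?r *\<^sub>R X) (?r *\<^sub>R X) p = ?r * ?r * G X X p"
      using DV[OF X] by (simp add: metric_bilinear closed)
    also have "\<dots> = G X X p / \<bar>G X X p\<bar>" by simp
    finally have "B (?r *\<^sub>R X) (?r *\<^sub>R X) p = 0"
      using e by (intro unit Dscale X) (auto simp: abs_if)
    then show ?thesis using DV[OF X] e by (simp add: B_linear closed)
  qed
  have diag: "B X X p = 0" if X: "X \<in> D" for X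
  proof (cases "\<forall>Y\<in>D. G Y Y p = 0")
    case True
    \<comment> \<open>\<open>P X\<close> represents \<open>B\<close> applied to \<open>X\<close>,
      and it is contact because \<open>B\<close> vanishes on \<open>\<xi>\<close>. If all contact
      vectors are null, polarising at \<open>P X\<close> and \<open>X\<close> gives
      \<open>G (P X) X p = 0\<close>, which is half of \<open>B X X p\<close>.\<close>
    have P: "P X \<in> D"
      using X B_metric[of X \<xi> p] B_xi[of X p] B_sym[of X \<xi> p] metric_sym[of "P X" \<xi> p]
      by (simp add: D_def P_closed closed)
    have "G (P X + X) (P X + X) p = 0" "G (P X) (P X) p = 0" "G X X p = 0"
      using True Dadd[OF P X] P X by auto
    then show ?thesis
      using DV[OF X] DV[OF P] by (simp add: metric_bilinear closed B_metric metric_sym[of X "P X"])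
  next
    case False
    then obtain Y where Y: "Y \<in> D" "G Y Y p \<noteq> 0" by auto
    have V: "X \<in> VF" "Y \<in> VF" using X Y DV by auto
    show ?thesis
    proof (rule ccontr)
      assume nz: "B X X p \<noteq> 0"
      then have null: "G X X p = 0" using nonnull[OF X] by auto
      \<comment> \<open>\<open>null\<close> removes the constant term of the first quadratic, and
        \<open>nonnull\<close> applied to \<open>Y\<close> the leading term of the second.\<close>
      have exp: "G (X + t *\<^sub>R Y) (X + t *\<^sub>R Y) p = t * (2 * G X Y p + t * G Y Y p)"
        and bexp: "B (X + t *\<^sub>R Y) (X + t *\<^sub>R Y) p = B X X p + 2 * t * B X Y p" for t
        using V null nonnull[OF Y]
        by (simp_all add: metric_bilinear closed metric_sym[of Y X] B_linear B_sym[of Y X]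
            algebra_simps)
      \<comment> \<open>The second root of \<open>t * (2 * G X Y p + t * G Y Y p)\<close>, next to
        \<open>t = 0\<close>.\<close>
      define s where "s = - 2 * G X Y p / G Y Y p"
      then have s: "2 * G X Y p = - s * G Y Y p" using Y(2) by simp
      have dich: "t = 0 \<or> t = s \<or> B X X p + 2 * t * B X Y p = 0" for t
      proof (cases "G (X + t *\<^sub>R Y) (X + t *\<^sub>R Y) p = 0")
        case True
        then have "t = 0 \<or> (t - s) * G Y Y p = 0" using exp[of t] s by (simp add: algebra_simps)
        then show ?thesis using Y(2) by auto
      next
        case False
        then show ?thesis
          using nonnull[of "X + t *\<^sub>R Y"] bexp[of t] Dadd[OF X Dscale[OF Y(1)]] by simp
      qed
      \<comment> \<open>An affine function of \<open>t\<close> that is nonzero at 0 has at most one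
        root, and only one value of \<open>t\<close> equals \<open>s\<close>, so \<open>dich\<close>
        cannot hold at all four of these nonzero values.\<close>
      show False
        using dich[of 1] dich[of "-1"] dich[of 2] dich[of "-2"] nz by argo
    qed
  qed
  have polar: "B X Y p = 0" if "X \<in> D" "Y \<in> D" for X Y
    using diag[OF Dadd[OF that]] diag[OF that(1)] diag[OF that(2)] DV[OF that(1)] DV[OF that(2)]
    by (simp add: B_linear closed B_sym[of Y X])
  let ?D = "\<lambda>X. X - fmult (G \<xi> X) \<xi>"
  have "?D V \<in> D" if "V \<in> VF" for V
    using that
    by (simp add: D_def closed fmult_xi_closed metric_diff_right metric_fmult_right metric_xi_xi)
  then have "B (?D X) (?D Y) p = 0" using polar XY by simp
  then show ?thesis
    using XY B_sub_xi[of X "?D Y" p] B_sub_xi[of Y X p] B_sym[of X "?D Y" p] B_sym[of X Y p]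
    by (simp add: closed fmult_xi_closed)
qed

end

section \<open>The Ricci tensor in dimension three\<close>

lemma linear_from_sum:
  assumes "subspace V" "linear_from V f" "finite I" "\<And>i. i \<in> I \<Longrightarrow> v i \<in> V"
  shows "f (\<Sum>i\<in>I. c i *\<^sub>R v i) = (\<Sum>i\<in>I. c i *\<^sub>R f (v i))"
  using assms(3,4)
proof (induction I rule: finite_induct)
  case empty
  have "\<forall>r. \<forall>u\<in>V. f (r *\<^sub>R u) = r *\<^sub>R f u" using assms(2) by (simp add: linear_from_def)
  from this[rule_format, OF subspace_0[OF assms(1)], of 0] show ?case by simp
next
  case (insert i I)
  have "c i *\<^sub>R v i \<in> V" "(\<Sum>i\<in>I. c i *\<^sub>R v i) \<in> V"
    using insert.prems assms(1) by (auto intro!: subspace_scale subspace_sum)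
  then show ?case using insert assms(2) by (simp add: linear_from_def)
qed

text \<open>\<open>trace_on\<close> refers to an unspecified basis. Expanding \<open>F b\<close> in
  the frame and each \<open>e j\<close> in the basis, then exchanging the sums, is the identity
  tr(UV) = tr(VU) and moves the trace to the frame.\<close>

lemma trace_on_frame:
  assumes V: "subspace V" and J: "finite J" and e: "\<And>j. j \<in> J \<Longrightarrow> e j \<in> V"
    and frame: "\<And>v. v \<in> V \<Longrightarrow> v = (\<Sum>j\<in>J. \<theta> j v *\<^sub>R e j)"
    and \<theta>: "\<And>j. j \<in> J \<Longrightarrow> linear_from V (\<theta> j)"
    and F: "linear_from V F" "\<And>v. v \<in> V \<Longrightarrow> F v \<in> V"
  shows "trace_on V F = (\<Sum>j\<in>J. \<theta> j (F (e j)))"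
proof -
  define B where "B = (SOME B. independent B \<and> span B = V)"
  have "\<exists>B. independent B \<and> span B = V"
  proof -
    obtain B where "B \<subseteq> V" "independent B" "V \<subseteq> span B" by (rule basis_exists)
    then show ?thesis using span_minimal[OF _ V, of B] by (metis subset_antisym)
  qed
  then have B: "independent B" "span B = V" unfolding B_def by (rule someI2_ex; simp)+
  then have BV: "b \<in> V" if "b \<in> B" for b using span_base[OF that] by simp
  have "V \<subseteq> span (e ` J)"
  proof
    fix v assume "v \<in> V"
    then show "v \<in> span (e ` J)"
      by (subst frame) (assumption, rule span_sum, rule span_scale, rule span_base, simp)
  qed
  then have finB: "finite B"
    using independent_span_bound[OF finite_imageI[OF J] B(1)] BV by blast
  have "trace_on V F = (\<Sum>b\<in>B. representation B (F b) b)"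
    by (simp add: trace_on_def B_def Let_def)
  also have "\<dots> = (\<Sum>b\<in>B. \<Sum>j\<in>J. representation B (e j) b * \<theta> j (F b))"
  proof (rule sum.cong[OF refl])
    fix b assume b: "b \<in> B"
    have "representation B (F b) = representation B (\<Sum>j\<in>J. \<theta> j (F b) *\<^sub>R e j)"
      using frame[OF F(2)[OF BV[OF b]]] by simp
    then show "representation B (F b) b = (\<Sum>j\<in>J. representation B (e j) b * \<theta> j (F b))"
      using e
      by (simp add: representation_sum[OF B(1)] representation_scale[OF B(1)] B(2)
          subspace_scale[OF V] mult.commute)
  qed
  also have "\<dots> = (\<Sum>j\<in>J. \<Sum>b\<in>B. representation B (e j) b * \<theta> j (F b))"
    by (rule sum.swap)
  also have "\<dots> = (\<Sum>j\<in>J. \<theta> j (F (e j)))"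
  proof (rule sum.cong[OF refl])
    fix j assume j: "j \<in> J"
    have "\<theta> j (F (e j)) = \<theta> j (F (\<Sum>b\<in>B. representation B (e j) b *\<^sub>R b))"
      using sum_representation_eq[OF B(1) _ finB subset_refl] e[OF j] B(2) by simp
    also have "\<dots> = (\<Sum>b\<in>B. representation B (e j) b *\<^sub>R \<theta> j (F b))"
      using BV F(2)
      by (simp add: linear_from_sum[OF V F(1) finB, of "\<lambda>b. b"]
          linear_from_sum[OF V \<theta>[OF j] finB, of "\<lambda>b. F b"])
    finally show "(\<Sum>b\<in>B. representation B (e j) b * \<theta> j (F b)) = \<theta> j (F (e j))" by simp
  qed
  finally show ?thesis .
qed

section \<open>Curvature as an endomorphism of a tangent space\<close>

context levi_civita
begin

text \<open>Moves \<open>X\<close> into the last slot, a plain argument of the metric, where visibly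
  only its value at \<open>p\<close> counts and linearity is immediate.\<close>

lemma curvature4_swap_pairs:
  assumes "X \<in> VF" "Y \<in> VF" "Z \<in> VF" "W \<in> VF"
  shows "R4 X Y Z W p = - R4 Z W Y X p"
  using curvature4_pair[OF assms] curvature4_skew34[OF assms(3,4,1,2)] by simp

lemma nondegenerate:
  assumes ext: "\<And>v. v \<in> tangent_space A p \<Longrightarrow> \<exists>X\<in>VF. X p = v"
    and "V \<in> VF" "V' \<in> VF" and "\<And>W. W \<in> VF \<Longrightarrow> G V W p = G V' W p"
  shows "V p = V' p"
proof -
  have "g p ((V - V') p) w = 0" if w: "w \<in> tangent_space A p" for w
  proof -
    obtain W where W: "W \<in> VF" "W p = w" using ext[OF w] by auto
    then have "G (V - V') W p = 0" using assms by (simp add: metric_bilinear)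
    then show ?thesis using W by (simp add: app2_def)
  qed
  moreover have "u = 0" if "u \<in> tangent_space A p" "\<forall>v\<in>tangent_space A p. g p u v = 0" for u
    using metric that by (simp add: pseudo_riemannian_metric_def)
  ultimately have "(V - V') p = 0"
    using vector_field_tangent[OF vector_fields_diff[OF assms(2,3)], of p] by presburger
  then show ?thesis by simp
qed

text \<open>Makes the description in \<open>at_point\<close> definite: after
  \<open>curvature4_swap_pairs\<close>, two fields with the same value at \<open>p\<close> give
  curvatures with equal pairings, and nondegeneracy identifies their values.\<close>

lemma at_point_curvature:
  assumes ext: "\<And>v. v \<in> tangent_space A p \<Longrightarrow> \<exists>X\<in>VF. X p = v"
    and "X \<in> VF" "Y \<in> VF" "Z \<in> VF"
  shows "at_point A p (\<lambda>X. curvature nabla X Y Z) (X p) = curvature nabla X Y Z p"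
  unfolding at_point_def
proof (rule the_equality)
  show "\<exists>X'\<in>VF. X' p = X p \<and> curvature nabla X' Y Z p = curvature nabla X Y Z p"
    by (rule bexI[OF _ assms(2)]) simp
  fix w assume "\<exists>X'\<in>VF. X' p = X p \<and> curvature nabla X' Y Z p = w"
  then obtain X' where X': "X' \<in> VF" "X' p = X p" and w: "w = curvature nabla X' Y Z p" by auto
  have "G (curvature nabla X' Y Z) W p = G (curvature nabla X Y Z) W p" if "W \<in> VF" for W
    using curvature4_swap_pairs[OF X'(1) assms(3,4) that, of p]
      curvature4_swap_pairs[OF assms(2-4) that, of p] X'(2)
    by (simp add: curvature4_def app2_def)
  then show "w = curvature nabla X Y Z p"
    unfolding w
    by (intro nondegenerate[OF ext, where V = "curvature nabla X' Y Z"
          and V' = "curvature nabla X Y Z"])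
      (simp_all add: curvature_closed assms(2-4) X')
qed

lemma linear_at_point_curvature:
  assumes ext: "\<And>v. v \<in> tangent_space A p \<Longrightarrow> \<exists>X\<in>VF. X p = v"
    and YZ: "Y \<in> VF" "Z \<in> VF"
  shows "linear_from (tangent_space A p) (at_point A p (\<lambda>X. curvature nabla X Y Z))"
  unfolding linear_from_def
proof (intro conjI ballI allI)
  let ?F = "\<lambda>X. curvature nabla X Y Z"
  fix u assume u: "u \<in> tangent_space A p"
  then obtain U where U: "U \<in> VF" "U p = u" using ext[OF u] by auto
  have lin: "G (?F X) W p = - G (curvature nabla Z W Y) X p" if "X \<in> VF" "W \<in> VF" for X W
    using curvature4_swap_pairs[OF that(1) YZ that(2)] by (simp add: curvature4_def)
  {
    fix v assume v: "v \<in> tangent_space A p"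
    then obtain V where V: "V \<in> VF" "V p = v" using ext[OF v] by auto
    have "?F (U + V) p = (?F U + ?F V) p"
    proof (rule nondegenerate[OF ext, where V = "?F (U + V)" and V' = "?F U + ?F V"])
      fix W assume W: "W \<in> VF"
      then show "G (?F (U + V)) W p = G (?F U + ?F V) W p"
        using U V YZ by (simp add: lin metric_bilinear field_closed curvature_closed)
    qed (use U V YZ in \<open>simp_all add: field_closed curvature_closed\<close>)
    then show "at_point A p ?F (u + v) = at_point A p ?F u + at_point A p ?F v"
      using at_point_curvature[OF ext _ YZ, of "U + V"] at_point_curvature[OF ext _ YZ, of U]
        at_point_curvature[OF ext _ YZ, of V] U V
      by (simp add: field_closed)
  }
  fix r
  have sc: "(r *\<^sub>R X) p = r *\<^sub>R X p" for X :: "'a vector_field"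
    by (simp add: scaleR_fun_def[of r X])
  have "?F (r *\<^sub>R U) p = (r *\<^sub>R ?F U) p"
  proof (rule nondegenerate[OF ext, where V = "?F (r *\<^sub>R U)" and V' = "r *\<^sub>R ?F U"])
    fix W assume W: "W \<in> VF"
    then show "G (?F (r *\<^sub>R U)) W p = G (r *\<^sub>R ?F U) W p"
      using U YZ by (simp add: lin metric_bilinear field_closed curvature_closed)
  qed (use U YZ in \<open>simp_all add: field_closed curvature_closed\<close>)
  then show "at_point A p ?F (r *\<^sub>R u) = r *\<^sub>R at_point A p ?F u"
    using at_point_curvature[OF ext _ YZ, of "r *\<^sub>R U"] at_point_curvature[OF ext _ YZ, of U] U
    by (simp add: field_closed sc)
qed

end

section \<open>Null frame and Ricci tensor for \<open>n = 1\<close>\<close>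

context paracontact_metric
begin

text \<open>For \<open>n = 1\<close> both eigenspaces of \<open>\<phi>\<close> in the contact plane
  are lines, and they are null because \<open>\<phi>\<close> is an anti-isometry there. Hence the
  functional dual to \<open>E\<close> is a multiple of pairing with \<open>F\<close>, and
  conversely.\<close>

lemma null_frame:
  assumes "n = 1"
  obtains E F a b c where "E \<in> VF" "F \<in> VF" "G E F p \<noteq> 0"
    and "\<phi> p (E p) = E p" "\<phi> p (F p) = - F p"
    and "\<And>v. v \<in> tangent_space A p \<Longrightarrow> \<exists>X\<in>VF. X p = v"
    and "\<And>v. v \<in> tangent_space A p \<Longrightarrow>
      v = g p (\<xi> p) v *\<^sub>R \<xi> p + (g p (F p) v / G E F p) *\<^sub>R E p + (g p (E p) v / G E F p) *\<^sub>R F p"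
proof -
  let ?T = "tangent_space A p"
  note sub = tangent_space_subspace[of A p]
  have lphi: "linear_from ?T (\<phi> p)" and leta: "linear_from ?T (\<eta> p)"
    and phiT: "\<And>u. u \<in> ?T \<Longrightarrow> \<phi> p u \<in> ?T"
    using paracontact
    by (auto simp: paracontact_metric_manifold_def almost_paracontact_def endomorphism_field_def
        one_form_def)
  let ?V = "\<lambda>s. {u \<in> ?T. \<eta> p u = 0 \<and> \<phi> p u = s *\<^sub>R u}"
  have line: "\<exists>e\<in>?V s. e \<noteq> 0 \<and> (\<forall>u\<in>?V s. \<exists>r. u = r *\<^sub>R e)" if d: "dim (?V s) = 1" for s
  proof -
    obtain C where C: "C \<subseteq> ?V s" "independent C" "?V s \<subseteq> span C" "card C = dim (?V s)"
      by (rule basis_exists)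
    then obtain e where e: "C = {e}" using d by (auto simp: card_1_singleton_iff)
    then have "e \<noteq> 0" using C(2) dependent_zero by auto
    moreover have "\<exists>r. u = r *\<^sub>R e" if "u \<in> ?V s" for u
      using C(3) that unfolding e by (auto simp: span_singleton)
    ultimately show ?thesis using C(1) e by auto
  qed
  have d: "dim (?V 1) = 1" "dim (?V (-1)) = 1"
    using paracontact assms
    by (simp_all add: paracontact_metric_manifold_def almost_paracontact_def)
  from line[OF d(1)] obtain e where e: "e \<in> ?V 1"
    and e': "e \<noteq> 0 \<and> (\<forall>u\<in>?V 1. \<exists>r. u = r *\<^sub>R e)" by (rule bexE)
  from line[OF d(2)] obtain f where f: "f \<in> ?V (-1)"
    and f': "f \<noteq> 0 \<and> (\<forall>u\<in>?V (-1). \<exists>r. u = r *\<^sub>R f)" by (rule bexE)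
  have xiT: "\<xi> p \<in> ?T" using vector_field_tangent[OF xi_closed] .
  have dec: "\<exists>b c. u = \<eta> p u *\<^sub>R \<xi> p + b *\<^sub>R e + c *\<^sub>R f" if u: "u \<in> ?T" for u
  proof -
    let ?w = "\<phi> p (\<phi> p u)"
    have T: "\<phi> p u \<in> ?T" "?w \<in> ?T" using u phiT by auto
    have ppp: "\<phi> p ?w = \<phi> p u" using phi_phi[OF T(1)] eta_phi[OF u] by simp
    \<comment> \<open>On the contact part \<open>?w\<close> of \<open>u\<close>,
      \<open>\<phi>\<close> is an involution; these are its eigenprojections for
      \<open>s = 1\<close> and \<open>s = -1\<close>, and they add up to \<open>?w\<close>.\<close>
    have mem: "(1/2) *\<^sub>R (?w + s *\<^sub>R \<phi> p u) \<in> ?V s" if s: "s * s = 1" for s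
    proof -
      let ?z = "?w + s *\<^sub>R \<phi> p u"
      have sT: "s *\<^sub>R \<phi> p u \<in> ?T" "?z \<in> ?T"
        using T subspace_add[OF sub] subspace_scale[OF sub] by simp_all
      have "\<phi> p ?z = \<phi> p u + s *\<^sub>R ?w" "\<eta> p ?z = 0"
        using T sT(1) lphi leta ppp eta_phi[OF u] eta_phi[OF T(1)]
        by (simp_all add: linear_from_def)
      moreover have "\<phi> p u + s *\<^sub>R ?w = s *\<^sub>R ?z" using s by (simp add: scaleR_add_right)
      ultimately have "\<phi> p ((1/2) *\<^sub>R ?z) = s *\<^sub>R ((1/2) *\<^sub>R ?z)" "\<eta> p ((1/2) *\<^sub>R ?z) = 0"
        using sT(2) lphi leta by (simp_all add: linear_from_def scaleR_left_commute)
      then show ?thesis using subspace_scale[OF sub sT(2)] by blast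
    qed
    from bspec[OF conjunct2[OF e'] mem[of 1]] bspec[OF conjunct2[OF f'] mem[of "-1"]]
    obtain b c where bc: "(1/2) *\<^sub>R (?w + 1 *\<^sub>R \<phi> p u) = b *\<^sub>R e"
      "(1/2) *\<^sub>R (?w + (-1) *\<^sub>R \<phi> p u) = c *\<^sub>R f" by auto
    have "?w = (1/2) *\<^sub>R ((?w + 1 *\<^sub>R \<phi> p u) + (?w + (-1) *\<^sub>R \<phi> p u))"
      using scaleR_half_double[of ?w] by simp
    then have "?w = (1/2) *\<^sub>R (?w + 1 *\<^sub>R \<phi> p u) + (1/2) *\<^sub>R (?w + (-1) *\<^sub>R \<phi> p u)"
      by (simp only: scaleR_add_right)
    then have "u - \<eta> p u *\<^sub>R \<xi> p = b *\<^sub>R e + c *\<^sub>R f"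
      unfolding bc unfolding phi_phi[OF u] .
    then have "u = \<eta> p u *\<^sub>R \<xi> p + b *\<^sub>R e + c *\<^sub>R f" by (simp add: algebra_simps)
    then show ?thesis by (intro exI)
  qed
  have eT: "e \<in> ?T" "f \<in> ?T" and ph: "\<phi> p e = e" "\<phi> p f = - f" and et: "\<eta> p e = 0" "\<eta> p f = 0"
    using e f by auto
  have "?T \<subseteq> span {\<xi> p, e, f}"
  proof
    fix u assume "u \<in> ?T"
    from dec[OF this] obtain b c where u: "u = \<eta> p u *\<^sub>R \<xi> p + b *\<^sub>R e + c *\<^sub>R f" by (elim exE)
    show "u \<in> span {\<xi> p, e, f}"
      by (subst u, intro span_add span_scale span_base) simp_all
  qed
  \<comment> \<open>Three spanning vectors against dimension \<open>2 * n + 1 = 3\<close>: the bound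
    that \<open>tangent_vector_extends\<close> asks for.\<close>
  moreover have "card {\<xi> p, e, f} \<le> DIM('e)"
  proof -
    have "DIM('e) = 3" using paracontact assms by (simp add: paracontact_metric_manifold_def)
    then show ?thesis using card_length[of "[\<xi> p, e, f]"] by simp
  qed
  ultimately have ext: "\<exists>X\<in>VF. X p = v" if "v \<in> ?T" for v
    using tangent_vector_extends[of "{\<xi> p, e, f}" p v] that by simp
  obtain E where E: "E \<in> VF" "E p = e" using ext[OF eT(1)] by auto
  obtain F where F: "F \<in> VF" "F p = f" using ext[OF eT(2)] by auto
  note EF = E F
  have EE: "G E E p = 0" and FF: "G F F p = 0" and XE: "G \<xi> E p = 0" and XF: "G \<xi> F p = 0"
  proof -
    show "G \<xi> E p = 0" "G \<xi> F p = 0"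
      using EF et fun_cong[OF eta_metric[OF EF(1)], of p] fun_cong[OF eta_metric[OF EF(3)], of p]
      by (simp_all add: app_def)
    have "\<Phi> E p = E p" "\<Phi> F p = (- F) p" using EF ph by (simp_all add: app_def)
    then have "G (\<Phi> E) (\<Phi> E) p = G E E p" "G (\<Phi> F) (\<Phi> F) p = G (- F) (- F) p"
      by (simp_all add: app2_def)
    moreover have "G (- F) (- F) p = G F F p" using F(1) by (simp add: metric_bilinear closed)
    moreover have "app \<eta> E p = 0" "app \<eta> F p = 0" using EF et by (simp_all add: app_def)
    ultimately show "G E E p = 0" "G F F p = 0"
      using metric_phi_phi[OF E(1) E(1), of p] metric_phi_phi[OF F(1) F(1), of p] by simp_all
  qed
  have coeff: "b = g p (F p) v / G E F p" "c = g p (E p) v / G E F p" "a = g p (\<xi> p) v"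
    if nz: "G E F p \<noteq> 0" and v: "v = a *\<^sub>R \<xi> p + b *\<^sub>R E p + c *\<^sub>R F p" for a b c v
  proof -
    have V: "v = (a *\<^sub>R \<xi> + b *\<^sub>R E + c *\<^sub>R F) p"
      using v by (simp add: scaleR_fun_def[of _ \<xi>] scaleR_fun_def[of _ E] scaleR_fun_def[of _ F])
    have w: "g p (W p) v = a * G W \<xi> p + b * G W E p + c * G W F p" if "W \<in> VF" for W
    proof -
      have "g p (W p) v = G W (a *\<^sub>R \<xi> + b *\<^sub>R E + c *\<^sub>R F) p" unfolding V by (simp add: app2_def)
      then show ?thesis using that EF by (simp add: metric_bilinear closed)
    qed
    then show "b = g p (F p) v / G E F p" "c = g p (E p) v / G E F p" "a = g p (\<xi> p) v"
      using w[OF E(1)] w[OF F(1)] w[OF xi_closed] EE FF XE XF nz metric_xi_xi[of p]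
        metric_sym[OF E(1) xi_closed, of p] metric_sym[OF F(1) xi_closed, of p]
        metric_sym[OF F(1) E(1), of p]
      by simp_all
  qed
  \<comment> \<open>\<open>E p\<close> is orthogonal to \<open>\<xi> p\<close> and to itself;
    orthogonality to \<open>F p\<close> as well would contradict nondegeneracy.\<close>
  have nz: "G E F p \<noteq> 0"
  proof
    assume 0: "G E F p = 0"
    have "g p (E p) u = 0" if u: "u \<in> ?T" for u
    proof -
      from dec[OF u] obtain b c where "u = \<eta> p u *\<^sub>R \<xi> p + b *\<^sub>R e + c *\<^sub>R f" by (elim exE)
      then have V: "u = (\<eta> p u *\<^sub>R \<xi> + b *\<^sub>R E + c *\<^sub>R F) p"
        using EF by (simp add: scaleR_fun_def[of _ \<xi>] scaleR_fun_def[of _ E] scaleR_fun_def[of _ F])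
      have "G E (\<eta> p u *\<^sub>R \<xi> + b *\<^sub>R E + c *\<^sub>R F) p = 0"
        using EF EE XE 0 metric_sym[of E \<xi> p] by (simp add: metric_bilinear closed)
      then show ?thesis using V by (simp add: app2_def)
    qed
    then have "E p = 0"
      using metric EF(2) eT(1) by (simp add: pseudo_riemannian_metric_def)
    then show False using EF(2) e' by simp
  qed
  show thesis
  proof (rule that[OF EF(1,3) nz _ _ ext])
    fix v assume v: "v \<in> ?T"
    from dec[OF v] obtain b c where "v = \<eta> p v *\<^sub>R \<xi> p + b *\<^sub>R e + c *\<^sub>R f" by (elim exE)
    then have "v = \<eta> p v *\<^sub>R \<xi> p + b *\<^sub>R E p + c *\<^sub>R F p" using EF by simp
    from this coeff[OF nz this] show "v = g p (\<xi> p) v *\<^sub>R \<xi> p + (g p (F p) v / G E F p) *\<^sub>R E p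
        + (g p (E p) v / G E F p) *\<^sub>R F p"
      by simp
  qed (use EF ph in auto)
qed

lemma ricci_dim_3:
  assumes "n = 1" and XY: "X \<in> VF" "Y \<in> VF"
  shows "- B X Y p = ricci A nabla X Y p + ricci A nabla (\<Phi> X) (\<Phi> Y) p
    - app \<eta> X p * ricci A nabla \<xi> Y p - app \<eta> Y p * ricci A nabla \<xi> X p
    + app \<eta> X p * app \<eta> Y p * ricci A nabla \<xi> \<xi> p"
proof -
  obtain E F where EF: "E \<in> VF" "F \<in> VF" and nz: "G E F p \<noteq> 0"
    and ph: "\<phi> p (E p) = E p" "\<phi> p (F p) = - F p"
    and ext: "\<And>v. v \<in> tangent_space A p \<Longrightarrow> \<exists>X\<in>VF. X p = v"
    and frame: "\<And>v. v \<in> tangent_space A p \<Longrightarrow>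
      v = g p (\<xi> p) v *\<^sub>R \<xi> p + (g p (F p) v / G E F p) *\<^sub>R E p + (g p (E p) v / G E F p) *\<^sub>R F p"
    using null_frame[OF \<open>n = 1\<close>, of p] by metis
  let ?T = "tangent_space A p"
  let ?\<gamma> = "G E F p"
  have ricci: "ricci A nabla Y Z p
      = R4 Y \<xi> \<xi> Z p + (R4 E Y Z F p + R4 E Z Y F p) / ?\<gamma>" if YZ: "Y \<in> VF" "Z \<in> VF" for Y Z
  proof -
    let ?e = "\<lambda>j::nat. if j = 0 then \<xi> p else if j = 1 then E p else F p"
    let ?\<theta> = "\<lambda>(j::nat) v. if j = 0 then g p (\<xi> p) v else if j = 1 then g p (F p) v / ?\<gamma>
      else g p (E p) v / ?\<gamma>"
    let ?R = "at_point A p (\<lambda>X. curvature nabla X Y Z)"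
    have R: "?R (X p) = curvature nabla X Y Z p" if "X \<in> VF" for X
      by (rule at_point_curvature[OF ext that YZ])
    have "trace_on ?T ?R = (\<Sum>j\<in>{0,1,2}. ?\<theta> j (?R (?e j)))"
    proof (rule trace_on_frame[OF tangent_space_subspace])
      show "linear_from ?T (?\<theta> j)" if "j \<in> {0,1,2}" for j
        using metric_linear[OF xi_closed, of p] metric_linear[OF EF(1), of p]
          metric_linear[OF EF(2), of p]
        by (simp add: linear_from_def add_divide_distrib)
      show "linear_from ?T ?R" by (rule linear_at_point_curvature[OF ext YZ])
      show "?R v \<in> ?T" if "v \<in> ?T" for v
        using ext[OF that] R vector_field_tangent curvature_closed[OF _ YZ] by metis
      show "?e j \<in> ?T" for j
        using vector_field_tangent EF xi_closed by simp
      show "v = (\<Sum>j\<in>{0,1,2}. ?\<theta> j v *\<^sub>R ?e j)" if "v \<in> ?T" for v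
        using frame[OF that] by (simp add: add.assoc)
    qed simp
    then have "ricci A nabla Y Z p
        = G \<xi> (curvature nabla \<xi> Y Z) p + G F (curvature nabla E Y Z) p / ?\<gamma>
          + G E (curvature nabla F Y Z) p / ?\<gamma>"
      using R EF xi_closed by (simp add: ricci_def app2_def)
    also have "\<dots> = R4 \<xi> Y Z \<xi> p + (R4 E Y Z F p + R4 F Y Z E p) / ?\<gamma>"
      using YZ EF
      by (simp add: curvature4_def metric_sym[of _ "curvature nabla _ _ _"] curvature_closed
          xi_closed add_divide_distrib)
    also have "R4 \<xi> Y Z \<xi> p = R4 Y \<xi> \<xi> Z p"
      using curvature4_skew12[OF YZ(1) xi_closed YZ(2) xi_closed, of p]
        curvature4_skew34[OF YZ(1) xi_closed YZ(2) xi_closed, of p] by simp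
    \<comment> \<open>The contribution of \<open>F\<close> is that of \<open>E\<close> with
      \<open>Y\<close> and \<open>Z\<close> exchanged, so one bilinear expression and its transpose
      cover both.\<close>
    also have "R4 F Y Z E p = R4 E Z Y F p"
      using curvature4_pair[OF EF(2) YZ EF(1), of p]
        curvature4_skew12[OF YZ(2) EF(1) EF(2) YZ(1), of p]
        curvature4_skew34[OF EF(1) YZ(2) EF(2) YZ(1), of p] by simp
    finally show ?thesis .
  qed
  \<comment> \<open>\<open>T\<close> vanishes for \<open>Y = E\<close> and for \<open>Z = F\<close>
    by the skew symmetries. \<open>T2\<close> and \<open>T1\<close> below record this: the second
    slot sees only \<open>\<xi>\<close> and \<open>E\<close>, the first only \<open>\<xi>\<close>
    and \<open>F\<close>.\<close>
  define T where "T Y Z = R4 E Y Z F p" for Y Z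
  let ?b = "\<lambda>Z. G F Z p / ?\<gamma>" and ?c = "\<lambda>Z. G E Z p / ?\<gamma>"
  have exp: "R4 U V W Z p = G \<xi> Z p * R4 U V W \<xi> p + ?b Z * R4 U V W E p + ?c Z * R4 U V W F p"
    if "U \<in> VF" "V \<in> VF" "W \<in> VF" "Z \<in> VF" for U V W Z
  proof -
    let ?Z = "G \<xi> Z p *\<^sub>R \<xi> + ?b Z *\<^sub>R E + ?c Z *\<^sub>R F"
    have "Z p = ?Z p"
      using frame[OF vector_field_tangent[OF that(4)]]
      by (simp add: app2_def scaleR_fun_def[of _ \<xi>] scaleR_fun_def[of _ E] scaleR_fun_def[of _ F])
    then have "R4 U V W Z p = G (curvature nabla U V W) ?Z p"
      by (simp add: curvature4_def app2_def)
    then show ?thesis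
      using that EF by (simp add: curvature4_def metric_bilinear closed curvature_closed)
  qed
  have T2: "T Y Z = G \<xi> Z p * T Y \<xi> + ?b Z * T Y E" if YZ: "Y \<in> VF" "Z \<in> VF" for Y Z
    using exp[OF EF(1) YZ(1) EF(2) YZ(2)] curvature4_skew34[OF EF(1) YZ EF(2), of p]
      curvature4_skew34[OF EF(1) YZ(1) xi_closed EF(2), of p]
      curvature4_skew34[OF EF(1) YZ(1) EF, of p] curvature4_skew34[OF EF(1) YZ(1) EF(2,2), of p]
    by (simp add: T_def algebra_simps)
  have T1: "T Y Z = G \<xi> Y p * T \<xi> Z + ?c Y * T F Z" if YZ: "Y \<in> VF" "Z \<in> VF" for Y Z
    using exp[OF YZ(2) EF(2,1) YZ(1)] curvature4_pair[OF YZ(2) EF(2,1) YZ(1), of p]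
      curvature4_pair[OF YZ(2) EF(2,1) xi_closed, of p] curvature4_pair[OF YZ(2) EF(2,1,2), of p]
      curvature4_skew34[OF YZ(2) EF(2,1,1), of p]
    by (simp add: T_def)
  have phiE: "?b (\<Phi> Z) = ?b Z" and phiF: "?c (\<Phi> Z) = - ?c Z" if "Z \<in> VF" for Z
  proof -
    have "\<Phi> F p = (- F) p" "\<Phi> E p = E p" using ph by (simp_all add: app_def)
    then have "G (\<Phi> F) Z p = G (- F) Z p" "G (\<Phi> E) Z p = G E Z p"
      by (simp_all add: app2_def)
    then have "G F (\<Phi> Z) p = G F Z p" "G E (\<Phi> Z) p = - G E Z p"
      using metric_phi_skew[OF EF(2) that, of p] metric_phi_skew[OF EF(1) that, of p] that EF
      by (simp_all add: metric_minus_left)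
    then show "?b (\<Phi> Z) = ?b Z" "?c (\<Phi> Z) = - ?c Z" by simp_all
  qed
  \<comment> \<open>The terms in \<open>\<eta>\<close> remove every component involving
    \<open>\<xi>\<close>; the remaining product \<open>?c Y * ?b Z * T F E\<close> changes sign
    under \<open>\<Phi>\<close>, since \<open>?c\<close> does and \<open>?b\<close> does
    not.\<close>
  have TT: "T Y Z + T (\<Phi> Y) (\<Phi> Z) - G \<xi> Y p * T \<xi> Z - G \<xi> Z p * T Y \<xi>
      + G \<xi> Y p * G \<xi> Z p * T \<xi> \<xi> = 0" if "Y \<in> VF" "Z \<in> VF" for Y Z
  proof -
    have "T (\<Phi> Y) (\<Phi> Z) = - ?c Y * (?b Z * T F E)"
      using T1[of "\<Phi> Y" "\<Phi> Z"] T2[of F "\<Phi> Z"] that EF phiE[OF that(2)] phiF[OF that(1)]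
      by (simp add: closed metric_xi_phi)
    moreover have "T Y Z = G \<xi> Y p * T \<xi> Z + ?c Y * (G \<xi> Z p * T F \<xi> + ?b Z * T F E)"
      using T1[OF that] T2[OF EF(2) that(2)] by simp
    moreover have "T Y \<xi> = G \<xi> Y p * T \<xi> \<xi> + ?c Y * T F \<xi>"
      using T1[OF that(1) xi_closed] .
    ultimately show ?thesis by (simp add: algebra_simps)
  qed
  have "R4 \<xi> \<xi> \<xi> Z p = 0" if "Z \<in> VF" for Z
    using curvature4_skew12[OF xi_closed xi_closed xi_closed that, of p] by simp
  moreover have "R4 X \<xi> \<xi> Y p + R4 (\<Phi> X) \<xi> \<xi> (\<Phi> Y) p = - B X Y p"
    using XY by (simp add: xi_curvature closed B_phi_phi metric_phi_phi metric_xi_phi metric_h_phi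
        eta_metric)
  moreover have "(T X Y + T Y X) / ?\<gamma> + (T (\<Phi> X) (\<Phi> Y) + T (\<Phi> Y) (\<Phi> X)) / ?\<gamma>
      - G \<xi> X p * ((T \<xi> Y + T Y \<xi>) / ?\<gamma>) - G \<xi> Y p * ((T \<xi> X + T X \<xi>) / ?\<gamma>)
      + G \<xi> X p * G \<xi> Y p * ((T \<xi> \<xi> + T \<xi> \<xi>) / ?\<gamma>) = 0" (is "?Q = 0")
  proof -
    \<comment> \<open>The Ricci tensor contains \<open>T\<close> together with its transpose, so the
      sum splits into \<open>TT\<close> for \<open>X, Y\<close> and \<open>TT\<close> for
      \<open>Y, X\<close>.\<close>
    have "?Q = ((T X Y + T (\<Phi> X) (\<Phi> Y) - G \<xi> X p * T \<xi> Y - G \<xi> Y p * T X \<xi>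
          + G \<xi> X p * G \<xi> Y p * T \<xi> \<xi>)
        + (T Y X + T (\<Phi> Y) (\<Phi> X) - G \<xi> Y p * T \<xi> X - G \<xi> X p * T Y \<xi>
          + G \<xi> Y p * G \<xi> X p * T \<xi> \<xi>)) / ?\<gamma>"
      using nz by (simp add: field_simps)
    then show ?thesis using TT[OF XY] TT[OF XY(2,1)] by simp
  qed
  ultimately show ?thesis
    using XY by (simp add: ricci closed eta_metric T_def algebra_simps)
qed

end

theorem proposition3p2:
  fixes A :: "('a::{t2_space,second_countable_topology}, 'e::euclidean_space) atlas"
    and n :: nat
    and \<phi> :: "'a \<Rightarrow> 'a tangent_vector \<Rightarrow> 'a tangent_vector"
    and \<xi> :: "'a vector_field"
    and \<eta> :: "'a \<Rightarrow> 'a tangent_vector \<Rightarrow> real"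
    and g :: "'a \<Rightarrow> 'a tangent_vector \<Rightarrow> 'a tangent_vector \<Rightarrow> real"
    and nabla :: "'a vector_field \<Rightarrow> 'a vector_field \<Rightarrow> 'a vector_field"
  defines "\<tau> \<equiv> lie_derivative_metric \<xi> g"
    and "h \<equiv> h_tensor \<xi> \<phi>"
    and "K \<equiv> xi_sectional_curvature g nabla \<xi>"
    and "Ric \<equiv> ricci A nabla"
    and "\<XX> \<equiv> vector_fields A"
  assumes "paracontact_metric_manifold A n \<phi> \<xi> \<eta> g"
    and "levi_civita_connection A g nabla"
  shows
    "(\<forall>X\<in>\<XX>. \<forall>Y\<in>\<XX>.
        covariant_derivative nabla \<xi> \<tau> X Y = covariant_derivative nabla \<xi> \<tau> Y X)
     \<and> (\<forall>Y\<in>\<XX>. covariant_derivative nabla \<xi> \<tau> \<xi> Y = 0)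
     \<and> (\<forall>X\<in>\<XX>. \<forall>Y\<in>\<XX>.
        covariant_derivative nabla \<xi> \<tau> (app \<phi> X) (app \<phi> Y) = covariant_derivative nabla \<xi> \<tau> X Y)
     \<and> (\<forall>X\<in>\<XX>. \<forall>p. \<forall>\<epsilon>\<in>{1, -1}.
        app \<eta> X p = 0 \<and> app2 g X X p = \<epsilon> \<longrightarrow>
          K X p = - (1/2) * \<epsilon> * covariant_derivative nabla \<xi> \<tau> X X p - 1
                  + \<epsilon> * app2 g (h X) (h X) p)
     \<and> ((\<forall>X\<in>\<XX>. \<forall>Y\<in>\<XX>. covariant_derivative nabla \<xi> \<tau> X Y = 0) \<longleftrightarrow>
        (\<forall>p. \<forall>X\<in>\<XX>. \<forall>Y\<in>\<XX>. \<forall>\<epsilon>\<^sub>X\<in>{1, -1}. \<forall>\<epsilon>\<^sub>Y\<in>{1, -1}.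
          app \<eta> X p = 0 \<and> app2 g X X p = \<epsilon>\<^sub>X \<and> app \<eta> Y p = 0 \<and> app2 g Y Y p = \<epsilon>\<^sub>Y \<longrightarrow>
            K X p - K Y p = \<epsilon>\<^sub>X * app2 g (h X) (h X) p - \<epsilon>\<^sub>Y * app2 g (h Y) (h Y) p))
     \<and> (n = 1 \<longrightarrow> (\<forall>X\<in>\<XX>. \<forall>Y\<in>\<XX>. \<forall>p.
        - covariant_derivative nabla \<xi> \<tau> X Y p =
          Ric X Y p + Ric (app \<phi> X) (app \<phi> Y) p
          - app \<eta> X p * Ric \<xi> Y p - app \<eta> Y p * Ric \<xi> X p
          + app \<eta> X p * app \<eta> Y p * Ric \<xi> \<xi> p))"
proof -
  have smooth: "smooth_atlas A" and metric: "pseudo_riemannian_metric A g"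
    using assms(6) by (simp_all add: paracontact_metric_manifold_def compatible_metric_def)
  interpret paracontact_metric A g nabla n \<phi> \<xi> \<eta>
    by unfold_locales (fact smooth metric assms(6,7))+
  have i: "covariant_derivative nabla \<xi> \<tau> X Y = covariant_derivative nabla \<xi> \<tau> Y X"
    if "X \<in> \<XX>" "Y \<in> \<XX>" for X Y
    using B_sym that unfolding \<tau>_def \<XX>_def by blast
  have ii: "covariant_derivative nabla \<xi> \<tau> \<xi> Y = 0" if "Y \<in> \<XX>" for Y
    using B_xi that unfolding \<tau>_def \<XX>_def by (simp add: fun_eq_iff)
  have iii: "covariant_derivative nabla \<xi> \<tau> (app \<phi> X) (app \<phi> Y)
      = covariant_derivative nabla \<xi> \<tau> X Y" if "X \<in> \<XX>" "Y \<in> \<XX>" for X Y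
    using B_phi_phi that unfolding \<tau>_def \<XX>_def by blast
  have iv: "K X p = - (1/2) * \<epsilon> * covariant_derivative nabla \<xi> \<tau> X X p - 1 + \<epsilon> * app2 g (h X) (h X) p"
    if "X \<in> \<XX>" "\<epsilon> \<in> {1, -1}" "app \<eta> X p = 0 \<and> app2 g X X p = \<epsilon>" for X p \<epsilon>
    using xi_sectional_curvature[of X \<epsilon> p] that unfolding K_def h_def \<tau>_def \<XX>_def by simp
  have v: "(\<forall>X\<in>\<XX>. \<forall>Y\<in>\<XX>. covariant_derivative nabla \<xi> \<tau> X Y = 0) \<longleftrightarrow>
        (\<forall>p. \<forall>X\<in>\<XX>. \<forall>Y\<in>\<XX>. \<forall>\<epsilon>\<^sub>X\<in>{1, -1}. \<forall>\<epsilon>\<^sub>Y\<in>{1, -1}.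
          app \<eta> X p = 0 \<and> app2 g X X p = \<epsilon>\<^sub>X \<and> app \<eta> Y p = 0 \<and> app2 g Y Y p = \<epsilon>\<^sub>Y \<longrightarrow>
            K X p - K Y p = \<epsilon>\<^sub>X * app2 g (h X) (h X) p - \<epsilon>\<^sub>Y * app2 g (h Y) (h Y) p)"
    (is "?L \<longleftrightarrow> ?R")
  proof
    assume L: ?L
    have K: "K X p = - 1 + \<epsilon> * app2 g (h X) (h X) p"
      if "X \<in> \<XX>" "\<epsilon> \<in> {1, -1}" "app \<eta> X p = 0 \<and> app2 g X X p = \<epsilon>" for X p \<epsilon>
    proof -
      have "covariant_derivative nabla \<xi> \<tau> X X p = 0" using L that(1) by simp
      then show ?thesis using iv[OF that] by simp
    qed
    show ?R
    proof (intro allI ballI impI, elim conjE)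
      fix p X Y \<epsilon>\<^sub>X \<epsilon>\<^sub>Y
      assume a: "X \<in> \<XX>" "Y \<in> \<XX>" "\<epsilon>\<^sub>X \<in> {1, -1}" "\<epsilon>\<^sub>Y \<in> {1, -1}" "app \<eta> X p = 0"
        "app2 g X X p = \<epsilon>\<^sub>X" "app \<eta> Y p = 0" "app2 g Y Y p = \<epsilon>\<^sub>Y"
      show "K X p - K Y p = \<epsilon>\<^sub>X * app2 g (h X) (h X) p - \<epsilon>\<^sub>Y * app2 g (h Y) (h Y) p"
        using K[OF a(1,3) conjI[OF a(5,6)]] K[OF a(2,4) conjI[OF a(7,8)]] by linarith
    qed
  next
    assume R: ?R
    show ?L
    proof (intro ballI ext)
      fix X Y p assume XY: "X \<in> \<XX>" "Y \<in> \<XX>"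
      have "covariant_derivative nabla \<xi> \<tau> X Y p = 0"
        unfolding \<tau>_def
      proof (rule B_zero)
        fix X Y \<epsilon> \<epsilon>'
        assume a: "X \<in> vector_fields A" "Y \<in> vector_fields A" "\<epsilon> \<in> {1, -1}" "\<epsilon>' \<in> {1, -1}"
          "app \<eta> X p = 0" "app2 g X X p = \<epsilon>" "app \<eta> Y p = 0" "app2 g Y Y p = \<epsilon>'"
        show "xi_sectional_curvature g nabla \<xi> X p - xi_sectional_curvature g nabla \<xi> Y p
            = \<epsilon> * app2 g (h_tensor \<xi> \<phi> X) (h_tensor \<xi> \<phi> X) p
              - \<epsilon>' * app2 g (h_tensor \<xi> \<phi> Y) (h_tensor \<xi> \<phi> Y) p"
          by (rule R[unfolded K_def h_def \<XX>_def, rule_format, OF a(1-4)])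
            (intro conjI a(5-8))
      qed (use XY in \<open>simp_all add: \<XX>_def\<close>)
      then show "covariant_derivative nabla \<xi> \<tau> X Y p = 0 p" by simp
    qed
  qed
  have vi: "- covariant_derivative nabla \<xi> \<tau> X Y p =
          Ric X Y p + Ric (app \<phi> X) (app \<phi> Y) p
          - app \<eta> X p * Ric \<xi> Y p - app \<eta> Y p * Ric \<xi> X p
          + app \<eta> X p * app \<eta> Y p * Ric \<xi> \<xi> p"
    if "n = 1" "X \<in> \<XX>" "Y \<in> \<XX>" for X Y p
    using ricci_dim_3[OF that(1), of X Y p] that unfolding Ric_def \<tau>_def \<XX>_def by simp
  show ?thesis
    using i ii iii iv v vi by (intro conjI ballI allI impI) simp_all
qed

end
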